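(* Let $(B_t)_{t\ge 0}$ be a standard Brownian motion in one dimension and let $f:[0,1]\to\mathbb{R}$ be a continuous function. Then, almost surely, $$\underline{\dim}_M G_{[0,1]}(B+f) = \max\{\underline{\dim}_M G_{[0,1]}(B),\ \underline{\dim}_M G_{[0,1]}(f)\}$$ and $$\overline{\dim}_M G_{[0,1]}(B+f) = \max\{\underline{\dim}_M G_{[0,1]}(B),\ \overline{\dim}_M G_{[0,1]}(f)\}.$$
   Context: For a function $h:[0,1]\to\mathbb{R}$, $G_{[0,1]}(h)=\{(t,h(t)):t\in [0,1]\}\subset\mathbb{R}^{2}$ denotes the graph of $h$ over $[0,1]$; $(B+f)(t)=B_t+f(t)$. For a non-empty bounded set $E\subset\mathbb{R}^m$ and $\epsilon>0$, let $P(E,\epsilon)$ be the maximum number of pairwise disjoint balls of radius $\epsilon$ with centers in $E$. The upper and lower Minkowski (box) dimensions of $E$ are $$\overline{\dim}_M(E)=\limsup_{\epsilon\to 0}\frac{\log P(E,\epsilon)}{\log \epsilon^{-1}},\qquad \underline{\dim}_M(E)=\liminf_{\epsilon\to 0}\frac{\log P(E,\epsilon)}{\log \epsilon^{-1}}.$$ *)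

theory Defs
  imports "HOL-Probability.Probability"
begin

text \<open>Standard one-dimensional Brownian motion on an arbitrary probability space, with time
  set \<open>{0..}\<close>; \<open>B t\<close> is unconstrained for negative \<open>t\<close>.  The start at \<open>0\<close> and the
  continuity of paths are required only almost surely.\<close>

locale standard_brownian_motion = prob_space M for M :: "'a measure" +
  fixes B :: "real \<Rightarrow> 'a \<Rightarrow> real"
  assumes random_variable_at: "t \<ge> 0 \<Longrightarrow> random_variable borel (B t)"
    and starts_at_zero: "AE \<omega> in M. B 0 \<omega> = 0"
    and independent_increments:
      "\<lbrakk>0 \<le> s 0; \<And>i. i < n \<Longrightarrow> s i \<le> s (Suc i)\<rbrakk> \<Longrightarrow>
         indep_vars (\<lambda>_. borel) (\<lambda>i \<omega>. B (s (Suc i)) \<omega> - B (s i) \<omega>) {..<n::nat}"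
    and gaussian_increments: \<comment> \<open>\<open>normal_density\<close> takes the standard deviation\<close>
      "\<lbrakk>0 \<le> r; r < t\<rbrakk> \<Longrightarrow>
         distributed M lborel (\<lambda>\<omega>. B t \<omega> - B r \<omega>) (normal_density 0 (sqrt (t - r)))"
    and continuous_paths: "AE \<omega> in M. continuous_on {0..} (\<lambda>t. B t \<omega>)"

text \<open>The product type \<open>real \<times> real\<close> carries the Euclidean metric.\<close>

definition graph_over :: "real set \<Rightarrow> (real \<Rightarrow> real) \<Rightarrow> (real \<times> real) set" where
  "graph_over A h = {(t, h t) | t. t \<in> A}"

text \<open>Balls are open.  The maximum exists when \<open>E\<close> is bounded and \<open>\<epsilon> > 0\<close>; the value is
  unspecified when the cardinalities are unbounded.\<close>

definition packing_number :: "'a::euclidean_space set \<Rightarrow> real \<Rightarrow> nat" where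
  "packing_number E \<epsilon> =
     Max {card S | S. finite S \<and> S \<subseteq> E \<and> pairwise (\<lambda>x y. disjnt (ball x \<epsilon>) (ball y \<epsilon>)) S}"

definition upper_minkowski_dim :: "'a::euclidean_space set \<Rightarrow> ereal" where
  "upper_minkowski_dim E =
     Limsup (at_right 0) (\<lambda>\<epsilon>. ereal (ln (real (packing_number E \<epsilon>)) / ln (inverse \<epsilon>)))"

definition lower_minkowski_dim :: "'a::euclidean_space set \<Rightarrow> ereal" where
  "lower_minkowski_dim E =
     Liminf (at_right 0) (\<lambda>\<epsilon>. ereal (ln (real (packing_number E \<epsilon>)) / ln (inverse \<epsilon>)))"

end

theory Submission imports Defs
begin

text \<open>Cut \<open>[0, 1]\<close> into \<open>2 ^ m\<close> dyadic intervals, with \<open>2 ^ m\<close> comparable to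
  \<open>1 / \<epsilon>\<close>. Up to constant factors, the packing number of the graph of a continuous \<open>h\<close> at scale
  \<open>\<epsilon>\<close> is \<open>2 ^ m\<close> times one plus the sum of the oscillations of \<open>h\<close> over these intervals. Oscillation is
  subadditive, so each of the graphs of \<open>B + f\<close> and \<open>f\<close> has packing number at most a constant times the
  larger of those of the other one and of \<open>B\<close>. By Gaussian moment bounds and dyadic chaining the
  packing exponent of \<open>B\<close> is almost surely at most \<open>3 / 2\<close> in the limit. By Hoeffding's inequality, a
  positive fraction of the increments of \<open>B + f\<close> over the dyadic intervals has at least the
  typical Brownian size, whatever \<open>f\<close> is, so the packing exponents of \<open>B + f\<close> and (with \<open>f = 0\<close>) of
  \<open>B\<close> are almost surely at least \<open>3 / 2\<close> in the limit. Hence the exponents of \<open>B + f\<close> and \<open>f\<close>, both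
  truncated from below at \<open>3 / 2\<close>, differ by a null function.\<close>

section \<open>Packing numbers of graphs and dyadic oscillation\<close>

definition dyadic_interval :: "nat \<Rightarrow> nat \<Rightarrow> real set" where
  "dyadic_interval m k = {real k / 2 ^ m .. real (Suc k) / 2 ^ m}"

definition dyadic_osc :: "nat \<Rightarrow> (real \<Rightarrow> real) \<Rightarrow> real" where
  "dyadic_osc m h = (\<Sum>k<2 ^ m. diameter (h ` dyadic_interval m k))"

definition is_packing :: "'a::metric_space set \<Rightarrow> real \<Rightarrow> 'a set \<Rightarrow> bool" where
  "is_packing E \<epsilon> S \<longleftrightarrow>
     finite S \<and> S \<subseteq> E \<and> pairwise (\<lambda>x y. disjnt (ball x \<epsilon>) (ball y \<epsilon>)) S"

lemma packing_number_eq_Max: "packing_number E \<epsilon> = Max (card ` Collect (is_packing E \<epsilon>))"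
  unfolding packing_number_def is_packing_def by (rule arg_cong[where f = Max]) auto

section \<open>Dyadic intervals and the oscillation of a continuous function over them\<close>

lemma dyadic_interval_nonempty: "dyadic_interval m k \<noteq> {}"
  by (auto simp: dyadic_interval_def divide_simps)

lemma dyadic_interval_subset: "k < 2 ^ m \<Longrightarrow> dyadic_interval m k \<subseteq> {0..1}"
proof -
  assume "k < 2 ^ m"
  then have "Suc k \<le> 2 ^ m" by simp
  then have "real (Suc k) \<le> real (2 ^ m)" by (rule of_nat_mono)
  then show ?thesis by (auto simp: dyadic_interval_def divide_simps)
qed

lemma dyadic_interval_covers:
  assumes "t \<in> {0..1}"
  obtains k where "k < 2 ^ m" "t \<in> dyadic_interval m k"
proof (cases "t = 1")
  case True
  \<comment> \<open>The floor formula used for \<open>t < 1\<close> would give the index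
    \<open>2 ^ m\<close> here, which is out of range; the right endpoint belongs to the last closed
    interval.\<close>
  have "t \<in> dyadic_interval m (2 ^ m - 1)"
    using True by (auto simp: dyadic_interval_def divide_simps of_nat_diff)
  then show thesis using that[of "2 ^ m - 1"] by simp
next
  case False
  define k where "k = nat \<lfloor>t * 2 ^ m\<rfloor>"
  have t: "t * 2 ^ m \<ge> 0" "t * 2 ^ m < 2 ^ m" using assms False by auto
  then have k: "real k \<le> t * 2 ^ m" "t * 2 ^ m < real k + 1"
    unfolding k_def by (auto simp: of_nat_nat)
  then have "real k < 2 ^ m" using t by linarith
  then have "k < 2 ^ m" by simp
  moreover have "t \<in> dyadic_interval m k"
    using k by (simp add: dyadic_interval_def divide_simps)
  ultimately show thesis using that by blast
qed

lemma continuous_on_dyadic_interval: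
  assumes "continuous_on {0..1} h" "k < 2 ^ m"
  shows "continuous_on (dyadic_interval m k) h"
  using continuous_on_subset[OF assms(1) dyadic_interval_subset[OF assms(2)]] .

lemma compact_image_dyadic_interval:
  assumes "continuous_on {0..1} (h :: real \<Rightarrow> real)" "k < 2 ^ m"
  shows "compact (h ` dyadic_interval m k)"
  by (intro compact_continuous_image continuous_on_dyadic_interval assms)
    (simp add: dyadic_interval_def)

lemma abs_diff_le_dyadic_diameter:
  assumes "continuous_on {0..1} (h :: real \<Rightarrow> real)" "k < 2 ^ m"
    and "s \<in> dyadic_interval m k" "t \<in> dyadic_interval m k"
  shows "\<bar>h s - h t\<bar> \<le> diameter (h ` dyadic_interval m k)"
  using diameter_bounded_bound[of "h ` dyadic_interval m k" "h s" "h t"] assms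
    compact_imp_bounded[OF compact_image_dyadic_interval[OF assms(1,2)]]
  by (auto simp: dist_real_def)

lemma dyadic_diameter_nonneg:
  assumes "continuous_on {0..1} (h :: real \<Rightarrow> real)" "k < 2 ^ m"
  shows "0 \<le> diameter (h ` dyadic_interval m k)"
  using compact_imp_bounded[OF compact_image_dyadic_interval[OF assms]] by (rule diameter_ge_0)

lemma dyadic_osc_nonneg: "continuous_on {0..1} h \<Longrightarrow> 0 \<le> dyadic_osc m h"
  unfolding dyadic_osc_def by (intro sum_nonneg dyadic_diameter_nonneg) auto

text \<open>The hypothesis compares increments instead of asking for \<open>f = g + h\<close>, so
  that the lemma serves for a sum of two functions as well as for a difference.\<close>

lemma dyadic_osc_triangle:
  assumes "continuous_on {0..1} g" "continuous_on {0..1} h"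
    and "\<And>s t. \<lbrakk>s \<in> {0..1}; t \<in> {0..1}\<rbrakk> \<Longrightarrow> \<bar>f s - f t\<bar> \<le> \<bar>g s - g t\<bar> + \<bar>h s - h t\<bar>"
  shows "dyadic_osc m f \<le> dyadic_osc m g + dyadic_osc m h"
  unfolding dyadic_osc_def sum.distrib[symmetric]
proof (rule sum_mono)
  fix k assume "k \<in> {..<(2::nat) ^ m}"
  then have k: "k < 2 ^ m" by simp
  show "diameter (f ` dyadic_interval m k) \<le>
      diameter (g ` dyadic_interval m k) + diameter (h ` dyadic_interval m k)"
  proof (rule diameter_le)
    show "f ` dyadic_interval m k \<noteq> {} \<or>
        0 \<le> diameter (g ` dyadic_interval m k) + diameter (h ` dyadic_interval m k)"
      using dyadic_interval_nonempty by simp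
    fix x y assume "x \<in> f ` dyadic_interval m k" "y \<in> f ` dyadic_interval m k"
    then obtain s t where st: "s \<in> dyadic_interval m k" "t \<in> dyadic_interval m k"
      "x = f s" "y = f t" by auto
    then have "\<bar>x - y\<bar> \<le> \<bar>g s - g t\<bar> + \<bar>h s - h t\<bar>"
      using assms(3)[of s t] dyadic_interval_subset[OF k] by blast
    also have "\<dots> \<le> diameter (g ` dyadic_interval m k) + diameter (h ` dyadic_interval m k)"
      using assms k st by (intro add_mono abs_diff_le_dyadic_diameter) auto
    finally show "norm (x - y) \<le> \<dots>" by simp
  qed
qed

section \<open>Comparison of packing numbers with the oscillation sum\<close>

lemma card_floor_interval_le:
  assumes "c \<le> (d :: real)"
  shows "real (card {\<lfloor>c\<rfloor>..\<lfloor>d\<rfloor>}) \<le> d - c + 2"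
proof -
  have "\<lfloor>c\<rfloor> \<le> \<lfloor>d\<rfloor>" using assms by (rule floor_mono)
  then have "real (card {\<lfloor>c\<rfloor>..\<lfloor>d\<rfloor>}) = real_of_int (\<lfloor>d\<rfloor> - \<lfloor>c\<rfloor> + 1)" by simp
  also have "\<dots> \<le> d - c + 2" by linarith
  finally show ?thesis .
qed

text \<open>Measuring from the least element of \<open>A\<close> instead of from \<open>a\<close>
  avoids rounding the real number \<open>a\<close>.\<close>

lemma card_nat_between_le:
  assumes "\<And>k. k \<in> A \<Longrightarrow> a \<le> real k" "\<And>k. k \<in> A \<Longrightarrow> real k \<le> a + real n"
  shows "card A \<le> n + 1"
proof (cases "A = {}")
  case False
  define l where "l = (LEAST k. k \<in> A)"
  have "l \<in> A" using False unfolding l_def by (metis LeastI equals0I)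
  have "A \<subseteq> {l..l + n}"
  proof
    fix k assume "k \<in> A"
    have "l \<le> k" unfolding l_def using \<open>k \<in> A\<close> by (rule Least_le)
    moreover have "real k \<le> real l + real n" using assms(1)[OF \<open>l \<in> A\<close>] assms(2)[OF \<open>k \<in> A\<close>] by simp
    then have "k \<le> l + n" by linarith
    ultimately show "k \<in> {l..l + n}" by simp
  qed
  then have "card A \<le> card {l..l + n}" by (intro card_mono) auto
  then show ?thesis by simp
qed simp

text \<open>The intermediate value theorem makes the diameter the length of an interval, which can
  be compared with a number of cells or with the total length of a cover.\<close>

lemma continuous_image_dyadic_interval:
  assumes "continuous_on {0..1} (h :: real \<Rightarrow> real)" "k < 2 ^ m"
  obtains c d where "h ` dyadic_interval m k = {c..d}" "c \<le> d"
    "diameter (h ` dyadic_interval m k) = d - c"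
proof -
  have "continuous_on {real k / 2 ^ m .. real (Suc k) / 2 ^ m} h"
    using continuous_on_dyadic_interval[OF assms] by (simp only: dyadic_interval_def)
  then obtain c d where cd: "h ` dyadic_interval m k = {c..d}" "c \<le> d"
    using continuous_image_closed_interval[of "real k / 2 ^ m" "real (Suc k) / 2 ^ m" h]
    by (auto simp: dyadic_interval_def divide_right_mono)
  have "diameter {c..d} \<le> d - c" by (rule diameter_le) (use cd in auto)
  moreover have "d - c \<le> diameter {c..d}"
    using diameter_bounded_bound[of "{c..d}" c d] cd by (auto simp: dist_real_def)
  ultimately show thesis using cd that by simp
qed

text \<open>Cut each column over a dyadic interval into squares of side \<open>1 / 2 ^ m\<close>.
  Two points in one square are closer than \<open>2 / 2 ^ m \<le> \<epsilon>\<close>, so a packing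
  has at most one point per square, and the graph meets at most \<open>2 ^ m * diameter + 2\<close>
  squares of a column.\<close>

lemma card_packing_le:
  assumes h: "continuous_on {0..1} h" and \<epsilon>: "2 / 2 ^ m \<le> \<epsilon>"
    and S: "is_packing (graph_over {0..1} h) \<epsilon> S"
  shows "real (card S) \<le> 2 * (2 ^ m * (dyadic_osc m h + 1))"
proof -
  define T where "T k = {x \<in> S. fst x \<in> dyadic_interval m k}" for k
  have fin: "finite S" using S by (simp add: is_packing_def)
  have \<epsilon>0: "0 < \<epsilon>" using \<epsilon> by (smt (verit) divide_pos_pos zero_less_power)
  have graph: "snd x = h (fst x)" "fst x \<in> {0..1}" if "x \<in> S" for x
    using S that by (auto simp: is_packing_def graph_over_def)
  have sep: "x = y" if "x \<in> S" "y \<in> S" "dist x y < \<epsilon>" for x y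
  proof (rule ccontr)
    assume "x \<noteq> y"
    then have "disjnt (ball x \<epsilon>) (ball y \<epsilon>)"
      using S that by (auto simp: is_packing_def pairwise_def)
    moreover have "y \<in> ball x \<epsilon>" "y \<in> ball y \<epsilon>" using that \<epsilon>0 by auto
    ultimately show False by (auto simp: disjnt_def)
  qed
  have col: "real (card (T k)) \<le> 2 ^ m * diameter (h ` dyadic_interval m k) + 2" if k: "k < 2 ^ m" for k
  proof -
    obtain c d where cd: "h ` dyadic_interval m k = {c..d}" "c \<le> d"
      "diameter (h ` dyadic_interval m k) = d - c"
      using continuous_image_dyadic_interval[OF h k] .
    \<comment> \<open>The number of the row that contains \<open>x\<close>; within column
      \<open>k\<close> it determines the square.\<close>
    define cell where "cell x = \<lfloor>2 ^ m * snd x\<rfloor>" for x :: "real \<times> real"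
    have "inj_on cell (T k)"
    proof (rule inj_onI)
      fix x y assume xy: "x \<in> T k" "y \<in> T k" "cell x = cell y"
      have "\<bar>2 ^ m * snd x - 2 ^ m * snd y\<bar> < 1"
        using xy(3) unfolding cell_def by linarith
      then have "2 ^ m * \<bar>snd x - snd y\<bar> < 1"
        by (simp add: abs_mult right_diff_distrib[symmetric])
      then have "\<bar>snd x - snd y\<bar> < 1 / 2 ^ m" by (simp add: field_simps)
      moreover have "\<bar>fst x - fst y\<bar> \<le> 1 / 2 ^ m"
        using xy by (auto simp: T_def dyadic_interval_def add_divide_distrib)
      moreover have "dist x y \<le> \<bar>fst x - fst y\<bar> + \<bar>snd x - snd y\<bar>"
        using sqrt_sum_squares_le_sum_abs[of "fst x - fst y" "snd x - snd y"] 
        by (auto simp: dist_prod_def dist_real_def)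
      ultimately have "dist x y < \<epsilon>" using \<epsilon> by simp
      then show "x = y" using sep xy by (simp add: T_def)
    qed
    moreover have "cell ` T k \<subseteq> {\<lfloor>2 ^ m * c\<rfloor>..\<lfloor>2 ^ m * d\<rfloor>}"
    proof
      fix z assume "z \<in> cell ` T k"
      then obtain x where x: "x \<in> T k" "z = cell x" by auto
      then have "snd x \<in> {c..d}" using graph(1)[of x] cd(1) by (auto simp: T_def)
      then show "z \<in> {\<lfloor>2 ^ m * c\<rfloor>..\<lfloor>2 ^ m * d\<rfloor>}"
        using x by (auto simp: cell_def intro!: floor_mono)
    qed
    ultimately have "card (T k) \<le> card {\<lfloor>2 ^ m * c\<rfloor>..\<lfloor>2 ^ m * d\<rfloor>}"
      by (intro card_inj_on_le) auto
    then have "real (card (T k)) \<le> 2 ^ m * d - 2 ^ m * c + 2"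
      using card_floor_interval_le[of "2 ^ m * c" "2 ^ m * d"] cd(2) by simp
    then show ?thesis using cd(3) by (simp add: right_diff_distrib)
  qed
  have "S \<subseteq> (\<Union>k<2 ^ m. T k)"
  proof
    fix x assume x: "x \<in> S"
    then obtain k where "k < 2 ^ m" "fst x \<in> dyadic_interval m k"
      using dyadic_interval_covers[OF graph(2)] by metis
    then show "x \<in> (\<Union>k<2 ^ m. T k)" using x by (auto simp: T_def)
  qed
  then have "card S \<le> card (\<Union>k<2 ^ m. T k)"
    using fin by (intro card_mono) (auto simp: T_def)
  also have "\<dots> \<le> (\<Sum>k<2 ^ m. card (T k))" by (rule card_UN_le) simp
  finally have "real (card S) \<le> (\<Sum>k<2 ^ m. real (card (T k)))"
    by (metis of_nat_mono of_nat_sum)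
  also have "\<dots> \<le> (\<Sum>k<2 ^ m. 2 ^ m * diameter (h ` dyadic_interval m k) + 2)"
    by (intro sum_mono col) auto
  also have "\<dots> = 2 ^ m * dyadic_osc m h + 2 ^ m * 2"
    by (simp add: sum.distrib dyadic_osc_def sum_distrib_left)
  also have "\<dots> \<le> 2 * (2 ^ m * (dyadic_osc m h + 1))"
    using dyadic_osc_nonneg[OF h, of m] by (simp add: algebra_simps)
  finally show ?thesis .
qed

text \<open>\<open>Max\<close> of an infinite set would be unspecified; the bound on all packings
  makes the packing number a genuine, attained maximum.\<close>

lemma finite_packing_cards:
  assumes "continuous_on {0..1} h" "2 / 2 ^ m \<le> \<epsilon>"
  shows "finite (card ` Collect (is_packing (graph_over {0..1} h) \<epsilon>))"
proof -
  have "card ` Collect (is_packing (graph_over {0..1} h) \<epsilon>) \<subseteq>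
      {..nat \<lceil>2 * (2 ^ m * (dyadic_osc m h + 1))\<rceil>}"
    using card_packing_le[OF assms] by (force intro: le_nat_floor simp: le_nat_iff le_ceiling_iff)
  then show ?thesis by (rule finite_subset) simp
qed

lemma packing_number_attained:
  assumes "continuous_on {0..1} h" "2 / 2 ^ m \<le> \<epsilon>"
  obtains S where "is_packing (graph_over {0..1} h) \<epsilon> S"
    "packing_number (graph_over {0..1} h) \<epsilon> = card S"
proof -
  have "is_packing (graph_over {0..1} h) \<epsilon> {}" by (simp add: is_packing_def)
  then have "card ` Collect (is_packing (graph_over {0..1} h) \<epsilon>) \<noteq> {}" by blast
  from Max_in[OF finite_packing_cards[OF assms] this] that show thesis
    by (auto simp: packing_number_eq_Max)
qed

lemma packing_number_upper:
  assumes "continuous_on {0..1} h" "2 / 2 ^ m \<le> \<epsilon>"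
  shows "real (packing_number (graph_over {0..1} h) \<epsilon>) \<le> 2 * (2 ^ m * (dyadic_osc m h + 1))"
  using packing_number_attained[OF assms] card_packing_le[OF assms] by metis

text \<open>Subadditivity of Lebesgue measure. The centres are indexed through \<open>y\<close>
  because \<open>T\<close> will be a set of points of the plane with \<open>y = snd\<close>, and
  several of them may have equal height.\<close>

lemma Icc_length_le_cover:
  assumes "finite T" "{c..d} \<subseteq> (\<Union>x\<in>T. {y x - r..y x + r})" "0 \<le> r"
  shows "d - c \<le> 2 * r * real (card T)"
proof (cases "c \<le> d")
  case True
  have "d - c = measure lborel {c..d}" using True by simp
  also have "\<dots> \<le> measure lborel (\<Union>x\<in>T. {y x - r..y x + r})"
  proof (rule measure_mono_fmeasurable[OF assms(2)])
    show "(\<Union>x\<in>T. {y x - r..y x + r}) \<in> fmeasurable lborel"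
      using assms(1) by (intro fmeasurable_compact compact_UN) auto
  qed simp
  also have "\<dots> \<le> (\<Sum>x\<in>T. measure lborel {y x - r..y x + r})"
    using assms(1) by (intro measure_UNION_le) auto
  also have "\<dots> = 2 * r * real (card T)" using assms(3) by simp
  finally show ?thesis .
next
  case False
  then show ?thesis using assms(3) by (smt (verit) mult_nonneg_nonneg of_nat_0_le_iff)
qed

text \<open>A packing of maximal cardinality is a \<open>2 \<epsilon>\<close>-net, and a ball of radius \<open>2 \<epsilon>\<close> meets boundedly
  many columns, in each of which it covers a bounded height.\<close>

lemma packing_number_lower:
  assumes h: "continuous_on {0..1} h" and \<epsilon>: "2 / 2 ^ m \<le> \<epsilon>" "\<epsilon> \<le> 4 / 2 ^ m"
  shows "2 ^ m * (dyadic_osc m h + 1) \<le> 306 * real (packing_number (graph_over {0..1} h) \<epsilon>)"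
proof -
  let ?G = "graph_over {0..1} h"
  obtain S where S: "is_packing ?G \<epsilon> S" "packing_number ?G \<epsilon> = card S"
    using packing_number_attained[OF h \<epsilon>(1)] .
  have fin: "finite S" using S by (simp add: is_packing_def)
  have \<epsilon>0: "0 < \<epsilon>" using \<epsilon> by (smt (verit) divide_pos_pos zero_less_power)
  \<comment> \<open>A point of the graph at distance at least \<open>2 * \<epsilon>\<close> from all
    of \<open>S\<close> could be added to \<open>S\<close>, against maximality.\<close>
  have net: "\<exists>x\<in>S. dist x z < 2 * \<epsilon>" if z: "z \<in> ?G" for z
  proof (rule ccontr)
    assume "\<not> (\<exists>x\<in>S. dist x z < 2 * \<epsilon>)"
    then have far: "2 * \<epsilon> \<le> dist x z" if "x \<in> S" for x using that by force
    have "z \<notin> S" using far[of z] \<epsilon>0 by auto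
    have "disjnt (ball x \<epsilon>) (ball z \<epsilon>)" "disjnt (ball z \<epsilon>) (ball x \<epsilon>)" if "x \<in> S" for x
      using disjoint_ballI[of \<epsilon> \<epsilon> x z] far[OF that] by (auto simp: disjnt_def)
    then have "is_packing ?G \<epsilon> (insert z S)"
      using S z by (auto simp: is_packing_def pairwise_insert)
    then have "card (insert z S) \<le> packing_number ?G \<epsilon>"
      unfolding packing_number_eq_Max
      by (intro Max_ge finite_packing_cards[OF h \<epsilon>(1)]) auto
    then show False using S \<open>z \<notin> S\<close> fin by simp
  qed
  \<comment> \<open>The columns met by the vertical strip of half-width
    \<open>2 * \<epsilon>\<close> around \<open>x\<close>.\<close>
  define N where "N x = {k \<in> {..<2 ^ m}. \<exists>t\<in>dyadic_interval m k. \<bar>fst x - t\<bar> < 2 * \<epsilon>}"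
    for x :: "real \<times> real"
  have near: "\<exists>x\<in>S. k \<in> N x \<and> \<bar>snd x - h t\<bar> < 2 * \<epsilon>"
    if "k < 2 ^ m" "t \<in> dyadic_interval m k" for k t
  proof -
    have "(t, h t) \<in> ?G" using that dyadic_interval_subset[of k m] by (auto simp: graph_over_def)
    then obtain x where x: "x \<in> S" "dist x (t, h t) < 2 * \<epsilon>" using net by blast
    moreover have "\<bar>fst x - t\<bar> \<le> dist x (t, h t)" "\<bar>snd x - h t\<bar> \<le> dist x (t, h t)"
      using dist_fst_le[of x "(t, h t)"] dist_snd_le[of x "(t, h t)"] by (auto simp: dist_real_def)
    ultimately have "\<bar>fst x - t\<bar> < 2 * \<epsilon>" "\<bar>snd x - h t\<bar> < 2 * \<epsilon>" by linarith+
    then show ?thesis using that x(1) by (auto simp: N_def)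
  qed
  \<comment> \<open>Each net point covers height \<open>4 * \<epsilon> \<le> 16 / 2 ^ m\<close>,
    which gives the 16; one more unit pays for the summand 1, because every column is near at least
    one net point.\<close>
  have col: "2 ^ m * diameter (h ` dyadic_interval m k) + 1 \<le> 17 * real (card {x \<in> S. k \<in> N x})"
    if k: "k < 2 ^ m" for k
  proof -
    let ?T = "{x \<in> S. k \<in> N x}"
    obtain c d where cd: "h ` dyadic_interval m k = {c..d}" "c \<le> d"
      "diameter (h ` dyadic_interval m k) = d - c"
      using continuous_image_dyadic_interval[OF h k] .
    have "{c..d} \<subseteq> (\<Union>x\<in>?T. {snd x - 2 * \<epsilon>..snd x + 2 * \<epsilon>})"
    proof
      fix v assume "v \<in> {c..d}"
      then obtain t where t: "t \<in> dyadic_interval m k" "v = h t" using cd(1) by (metis imageE)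
      then obtain x where "x \<in> S" "k \<in> N x" "\<bar>snd x - h t\<bar> < 2 * \<epsilon>" using near[OF k] by blast
      then show "v \<in> (\<Union>x\<in>?T. {snd x - 2 * \<epsilon>..snd x + 2 * \<epsilon>})"
        using t(2) by (intro UN_I[of x]) auto
    qed
    then have "d - c \<le> 2 * (2 * \<epsilon>) * real (card ?T)"
      using fin \<epsilon>0 by (intro Icc_length_le_cover) auto
    also have "\<dots> \<le> 16 / 2 ^ m * real (card ?T)" using \<epsilon> by (intro mult_right_mono) auto
    finally have "2 ^ m * (d - c) \<le> 16 * real (card ?T)" by (simp add: field_simps)
    moreover have "?T \<noteq> {}" using near[OF k] dyadic_interval_nonempty[of m k] by blast
    then have "card ?T \<ge> 1" using fin by (simp add: Suc_leI card_gt_0_iff)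
    ultimately show ?thesis using cd(3) by simp
  qed
  \<comment> \<open>In units of \<open>1 / 2 ^ m\<close> the strip reaches at most 8 to either side,
    and \<open>k\<close> is the left end of a column of width 1. Hence \<open>k\<close> lies between
    \<open>fst x * 2 ^ m - 9\<close> and \<open>fst x * 2 ^ m + 8\<close>, which leaves 18 values;
    \<open>17 * 18 = 306\<close>.\<close>
  have cardN: "card (N x) \<le> 17 + 1" for x
  proof (rule card_nat_between_le)
    fix k assume "k \<in> N x"
    then obtain t where t: "t \<in> dyadic_interval m k" "\<bar>fst x - t\<bar> < 2 * \<epsilon>" by (auto simp: N_def)
    then have "\<bar>fst x - t\<bar> \<le> 8 / 2 ^ m" using \<epsilon> by simp
    then have "\<bar>fst x - t\<bar> * 2 ^ m \<le> 8" by (simp add: field_simps)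
    then have "\<bar>fst x * 2 ^ m - t * 2 ^ m\<bar> \<le> 8"
      by (simp add: left_diff_distrib[symmetric] abs_mult)
    moreover have "real k \<le> t * 2 ^ m" "t * 2 ^ m \<le> real k + 1"
      using t(1) by (auto simp: dyadic_interval_def field_simps)
    ultimately show "fst x * 2 ^ m - 9 \<le> real k" "real k \<le> fst x * 2 ^ m - 9 + real 17" by auto
  qed
  have "2 ^ m * (dyadic_osc m h + 1) = (\<Sum>k<2 ^ m. 2 ^ m * diameter (h ` dyadic_interval m k) + 1)"
    by (simp add: sum.distrib dyadic_osc_def sum_distrib_left algebra_simps)
  also have "\<dots> \<le> (\<Sum>k<2 ^ m. 17 * real (card {x \<in> S. k \<in> N x}))"
    by (intro sum_mono col) auto
  also have "\<dots> = 17 * real (\<Sum>k<2 ^ m. card {x \<in> S. k \<in> N x})" by (simp add: sum_distrib_left)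
  \<comment> \<open>Double counting of the pairs of a column and a net point near it.\<close>
  also have "(\<Sum>k<2 ^ m. card {x \<in> S. k \<in> N x}) = (\<Sum>x\<in>S. card {k \<in> {..<2 ^ m}. k \<in> N x})"
    using fin by (intro sum_multicount_gen) auto
  also have "\<dots> = (\<Sum>x\<in>S. card (N x))" by (intro sum.cong arg_cong[where f = card]) (auto simp: N_def)
  also have "real \<dots> \<le> real (\<Sum>x\<in>S. 17 + 1)" by (intro of_nat_mono sum_mono cardN)
  finally show ?thesis using S(2) by simp
qed

section \<open>Dyadic chaining\<close>

text \<open>Induction on the level. A point of level \<open>m + Suc j\<close> with even index
  already belongs to level \<open>m + j\<close>; one with odd index is the right neighbour of such a
  point, at the cost of one increment \<open>r ^ (m + Suc j)\<close>. The term \<open>l = 0\<close>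
  pays for the right endpoint \<open>Suc k\<close> of the interval.\<close>

lemma dyadic_chaining_grid:
  fixes g :: "real \<Rightarrow> real"
  assumes r: "0 < r"
    and inc: "\<And>j i. m \<le> j \<Longrightarrow> i < 2 ^ j \<Longrightarrow> \<bar>g (real (Suc i) / 2 ^ j) - g (real i / 2 ^ j)\<bar> \<le> r ^ j"
    and k: "k < 2 ^ m"
    and i: "k * 2 ^ j \<le> i" "i \<le> Suc k * 2 ^ j"
  shows "\<bar>g (real i / 2 ^ (m + j)) - g (real k / 2 ^ m)\<bar> \<le> (\<Sum>l\<le>j. r ^ (m + l))"
  using i
proof (induction j arbitrary: i)
  case 0
  then have "i = k \<or> i = Suc k" by auto
  then show ?case using inc[of m k] k r by auto
next
  case (Suc j)
  define i' where "i' = i div 2"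
  have i': "k * 2 ^ j \<le> i'" "i' \<le> Suc k * 2 ^ j"
    using Suc.prems unfolding i'_def by auto
  note IH = Suc.IH[OF i']
  have pow: "(2::real) ^ (m + Suc j) = 2 * 2 ^ (m + j)" by simp
  show ?case
  proof (cases "even i")
    case True
    then have "real i = 2 * real i'" unfolding i'_def by (metis dvd_mult_div_cancel of_nat_mult of_nat_numeral)
    then have "real i / 2 ^ (m + Suc j) = real i' / 2 ^ (m + j)" unfolding pow by simp
    then show ?thesis using IH r by (simp add: add_increasing2)
  next
    case False
    then have odd: "i = Suc (2 * i')" unfolding i'_def by simp
    \<comment> \<open>The increment bound is available only for indices below
      \<open>2 ^ (m + Suc j)\<close>. The odd index \<open>i\<close> does not exceed that number, so
      its left neighbour \<open>2 * i'\<close> is strictly below it.\<close>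
    have "Suc k * 2 ^ Suc j \<le> 2 ^ m * 2 ^ Suc j" using k by (intro mult_right_mono) auto
    then have "2 * i' < 2 ^ (m + Suc j)"
      using Suc.prems(2) odd by (simp only: power_add)
    moreover have "real (2 * i') / 2 ^ (m + Suc j) = real i' / 2 ^ (m + j)" unfolding pow by simp
    ultimately have "\<bar>g (real i / 2 ^ (m + Suc j)) - g (real i' / 2 ^ (m + j))\<bar> \<le> r ^ (m + Suc j)"
      using inc[of "m + Suc j" "2 * i'"] odd by simp
    then show ?thesis using IH by simp
  qed
qed

text \<open>The largest grid points \<open>s j\<close> of level \<open>m + j\<close> not exceeding
  \<open>t\<close> stay in the same dyadic interval and converge to \<open>t\<close>. The bounds on
  the grid are dominated by a geometric series, and continuity carries them to
  \<open>t\<close>.\<close>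

lemma dyadic_chaining:
  fixes g :: "real \<Rightarrow> real"
  assumes g: "continuous_on {0..1} g" and r: "0 < r" "r < 1"
    and inc: "\<And>j i. m \<le> j \<Longrightarrow> i < 2 ^ j \<Longrightarrow> \<bar>g (real (Suc i) / 2 ^ j) - g (real i / 2 ^ j)\<bar> \<le> r ^ j"
    and k: "k < 2 ^ m" and t: "t \<in> dyadic_interval m k"
  shows "\<bar>g t - g (real k / 2 ^ m)\<bar> \<le> r ^ m / (1 - r)"
proof -
  have geo: "(\<Sum>l\<le>j. r ^ (m + l)) \<le> r ^ m / (1 - r)" for j
  proof -
    have "(\<Sum>l\<le>j. r ^ (m + l)) = r ^ m * (\<Sum>l<Suc j. r ^ l)"
      by (simp add: power_add sum_distrib_left lessThan_Suc_atMost)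
    also have "\<dots> \<le> r ^ m * (1 / (1 - r))"
      using r by (intro mult_left_mono) (simp_all add: sum_gp_strict divide_right_mono del: sum.lessThan_Suc)
    finally show ?thesis by simp
  qed
  define i where "i j = nat \<lfloor>t * 2 ^ (m + j)\<rfloor>" for j
  define s where "s j = real (i j) / 2 ^ (m + j)" for j
  have t': "real k \<le> t * 2 ^ m" "t * 2 ^ m \<le> real (Suc k)"
    using t by (auto simp: dyadic_interval_def field_simps)
  have i: "real (i j) \<le> t * 2 ^ (m + j)" "t * 2 ^ (m + j) < real (i j) + 1" for j
  proof -
    have "0 \<le> t" using t'(1) by (smt (verit) mult_neg_pos of_nat_0_le_iff zero_less_power)
    then have "0 \<le> t * 2 ^ (m + j)" by simp
    then show "real (i j) \<le> t * 2 ^ (m + j)" "t * 2 ^ (m + j) < real (i j) + 1"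
      unfolding i_def by (auto simp: of_nat_nat)
  qed
  have bounds: "k * 2 ^ j \<le> i j" "i j \<le> Suc k * 2 ^ j" for j
  proof -
    have "real k * 2 ^ j \<le> t * 2 ^ m * 2 ^ j" "t * 2 ^ m * 2 ^ j \<le> real (Suc k) * 2 ^ j"
      using t' by (auto intro!: mult_right_mono)
    moreover have "t * 2 ^ m * 2 ^ j = t * 2 ^ (m + j)" by (simp add: power_add)
    ultimately have "real k * 2 ^ j < real (i j) + 1" "real (i j) \<le> real (Suc k) * 2 ^ j"
      using i[of j] by linarith+
    then have "real (k * 2 ^ j) < real (Suc (i j))" "real (i j) \<le> real (Suc k * 2 ^ j)"
      by (simp_all add: distrib_right)
    then have "k * 2 ^ j < Suc (i j)" "i j \<le> Suc k * 2 ^ j"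
      unfolding of_nat_less_iff of_nat_le_iff by blast+
    then show "k * 2 ^ j \<le> i j" "i j \<le> Suc k * 2 ^ j"
      by simp_all
  qed
  have s_mem: "s j \<in> {0..1}" for j
  proof -
    have "Suc k * 2 ^ j \<le> 2 ^ m * 2 ^ j" using k by (intro mult_right_mono) auto
    then have "i j \<le> 2 ^ (m + j)" using bounds(2)[of j] by (simp only: power_add)
    then have "real (i j) \<le> 2 ^ (m + j)" by simp
    then show ?thesis by (simp add: s_def)
  qed
  have "(\<lambda>j. s j - t) \<longlonglongrightarrow> 0"
  proof (rule Lim_null_comparison)
    show "\<forall>\<^sub>F j in sequentially. norm (s j - t) \<le> (1 / 2) ^ (m + j)"
    proof (rule always_eventually, rule allI)
      fix j
      have "\<bar>real (i j) - t * 2 ^ (m + j)\<bar> \<le> 1" using i[of j] by linarith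
      then have "\<bar>(s j - t) * 2 ^ (m + j)\<bar> \<le> 1" by (simp add: s_def left_diff_distrib)
      then have "\<bar>s j - t\<bar> * 2 ^ (m + j) \<le> 1" by (simp only: abs_mult power_abs abs_numeral)
      then show "norm (s j - t) \<le> (1 / 2) ^ (m + j)" by (simp add: power_one_over field_simps)
    qed
    show "(\<lambda>j. (1 / 2 :: real) ^ (m + j)) \<longlonglongrightarrow> 0"
      unfolding power_add by (intro tendsto_mult_right_zero LIMSEQ_power_zero) simp
  qed
  then have lim: "s \<longlonglongrightarrow> t" by (simp add: LIM_zero_iff)
  have "t \<in> {0..1}" using t dyadic_interval_subset[OF k] by blast
  then have "(\<lambda>j. g (s j)) \<longlonglongrightarrow> g t"
    using continuous_on_tendsto_compose[OF g lim] s_mem by simp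
  then have "(\<lambda>j. \<bar>g (s j) - g (real k / 2 ^ m)\<bar>) \<longlonglongrightarrow> \<bar>g t - g (real k / 2 ^ m)\<bar>"
    by (intro tendsto_intros)
  moreover have "\<bar>g (s j) - g (real k / 2 ^ m)\<bar> \<le> r ^ m / (1 - r)" for j
    using dyadic_chaining_grid[OF r(1) inc k bounds, of j] geo[of j] unfolding s_def by linarith
  ultimately show ?thesis by (intro LIMSEQ_le_const2) auto
qed

lemma dyadic_osc_le_chaining:
  assumes g: "continuous_on {0..1} g" and r: "0 < r" "r < 1"
    and inc: "\<And>j i. m \<le> j \<Longrightarrow> i < 2 ^ j \<Longrightarrow> \<bar>g (real (Suc i) / 2 ^ j) - g (real i / 2 ^ j)\<bar> \<le> r ^ j"
  shows "dyadic_osc m g \<le> 2 ^ m * (2 * r ^ m / (1 - r))"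
proof -
  \<comment> \<open>Both points are compared with the left endpoint, hence the factor 2.\<close>
  have "diameter (g ` dyadic_interval m k) \<le> 2 * r ^ m / (1 - r)" if "k < 2 ^ m" for k
  proof (rule diameter_le)
    fix x y assume "x \<in> g ` dyadic_interval m k" "y \<in> g ` dyadic_interval m k"
    then obtain s t where "s \<in> dyadic_interval m k" "t \<in> dyadic_interval m k" "x = g s" "y = g t"
      by auto
    then show "norm (x - y) \<le> 2 * r ^ m / (1 - r)"
      using dyadic_chaining[OF g r inc that, of s] dyadic_chaining[OF g r inc that, of t] by simp
  qed (use dyadic_interval_nonempty in simp)
  then have "dyadic_osc m g \<le> (\<Sum>k<(2::nat) ^ m. 2 * r ^ m / (1 - r))"
    unfolding dyadic_osc_def by (intro sum_mono) auto
  then show ?thesis by simp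
qed

lemma sum_dyadic_increments_le_osc:
  assumes "continuous_on {0..1} g"
  shows "(\<Sum>k<2 ^ m. \<bar>g (real (Suc k) / 2 ^ m) - g (real k / 2 ^ m)\<bar>) \<le> dyadic_osc m g"
  unfolding dyadic_osc_def
  by (intro sum_mono abs_diff_le_dyadic_diameter assms)
    (auto simp: dyadic_interval_def divide_right_mono)

section \<open>Packing exponents\<close>

text \<open>For \<open>0 < \<epsilon> \<le> 1\<close> this is the least \<open>m\<close> with
  \<open>2 / 2 ^ m \<le> \<epsilon>\<close>; minimality yields
  \<open>\<epsilon> \<le> 4 / 2 ^ m\<close>. These are the two conditions on the scale in the
  packing bounds.\<close>

definition dyadic_level :: "real \<Rightarrow> nat" where
  "dyadic_level \<epsilon> = nat \<lceil>log 2 (2 / \<epsilon>)\<rceil>"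

lemma dyadic_level_bounds:
  assumes "0 < \<epsilon>" "\<epsilon> \<le> 1"
  shows "2 / 2 ^ dyadic_level \<epsilon> \<le> \<epsilon>" "\<epsilon> \<le> 4 / 2 ^ dyadic_level \<epsilon>"
proof -
  let ?m = "dyadic_level \<epsilon>"
  have pos: "0 \<le> log 2 (2 / \<epsilon>)" using assms by simp
  then have m: "log 2 (2 / \<epsilon>) \<le> real ?m" "real ?m - 1 < log 2 (2 / \<epsilon>)"
    unfolding dyadic_level_def by linarith+
  have "2 / \<epsilon> \<le> 2 powr real ?m" using m(1) assms by (simp add: log_le_iff)
  then show "2 / 2 ^ ?m \<le> \<epsilon>" using assms by (simp add: powr_realpow field_simps)
  have "2 powr (real ?m - 1) < 2 / \<epsilon>" using m(2) assms by (simp add: less_log_iff)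
  then show "\<epsilon> \<le> 4 / 2 ^ ?m" using assms by (simp add: powr_realpow powr_diff field_simps)
qed

text \<open>Turns statements about all large levels \<open>m\<close> into statements about all small
  \<epsilon>.\<close>

lemma filterlim_dyadic_level: "filterlim dyadic_level sequentially (at_right 0)"
  unfolding filterlim_at_top
proof
  fix m :: nat
  have "\<forall>\<^sub>F \<epsilon> in at_right 0. 0 < \<epsilon> \<and> \<epsilon> < min 1 (1 / 2 ^ m :: real)"
    unfolding eventually_at_right_field by (intro exI[of _ "min 1 (1 / 2 ^ m)"]) auto
  then show "\<forall>\<^sub>F \<epsilon> in at_right 0. m \<le> dyadic_level \<epsilon>"
  proof (rule eventually_mono)
    fix \<epsilon> :: real assume \<epsilon>: "0 < \<epsilon> \<and> \<epsilon> < min 1 (1 / 2 ^ m)"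
    then have bounds: "0 < \<epsilon>" "\<epsilon> \<le> 1" "\<epsilon> < 1 / 2 ^ m" by linarith+
    from le_less_trans[OF dyadic_level_bounds(1)[OF bounds(1,2)] bounds(3)]
    have "2 / 2 ^ dyadic_level \<epsilon> < 1 / (2 ^ m :: real)" .
    then have "2 ^ m * 2 < (2 :: real) ^ dyadic_level \<epsilon>" by (simp add: field_simps)
    then have "(2 :: real) ^ m < 2 ^ dyadic_level \<epsilon>" by (smt (verit) zero_less_power)
    then show "m \<le> dyadic_level \<epsilon>" by simp
  qed
qed

abbreviation graph_packing :: "(real \<Rightarrow> real) \<Rightarrow> real \<Rightarrow> real" where
  "graph_packing h \<epsilon> \<equiv> real (packing_number (graph_over {0..1} h) \<epsilon>)"

definition packing_exponent :: "(real \<Rightarrow> real) \<Rightarrow> real \<Rightarrow> real" where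
  "packing_exponent h \<epsilon> = ln (graph_packing h \<epsilon>) / ln (inverse \<epsilon>)"

lemma eventually_at_right_0_unit: "\<forall>\<^sub>F \<epsilon> in at_right 0. 0 < \<epsilon> \<and> \<epsilon> < (1 :: real)"
  unfolding eventually_at_right_field by (intro exI[of _ 1]) auto

lemma graph_packing_pos:
  assumes "continuous_on {0..1} h" "0 < \<epsilon>" "\<epsilon> \<le> 1"
  shows "1 \<le> graph_packing h \<epsilon>"
proof -
  have "0 < 2 ^ dyadic_level \<epsilon> * (dyadic_osc (dyadic_level \<epsilon>) h + 1)"
    using dyadic_osc_nonneg[OF assms(1), of "dyadic_level \<epsilon>"] by (intro mult_pos_pos) auto
  also have "\<dots> \<le> 306 * graph_packing h \<epsilon>"
    using packing_number_lower[OF assms(1) dyadic_level_bounds[OF assms(2,3)]] .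
  finally show ?thesis by simp
qed

text \<open>Packing numbers are replaced by oscillation sums at one common level, where the triangle
  inequality holds without loss, and back again; \<open>612 = 2 * 306\<close>.\<close>

lemma graph_packing_triangle:
  assumes cont: "continuous_on {0..1} f" "continuous_on {0..1} g" "continuous_on {0..1} h"
    and tri: "\<And>s t. \<lbrakk>s \<in> {0..1}; t \<in> {0..1}\<rbrakk> \<Longrightarrow> \<bar>f s - f t\<bar> \<le> \<bar>g s - g t\<bar> + \<bar>h s - h t\<bar>"
    and \<epsilon>: "0 < \<epsilon>" "\<epsilon> \<le> 1"
  shows "graph_packing f \<epsilon> \<le> 612 * (graph_packing g \<epsilon> + graph_packing h \<epsilon>)"
proof -
  let ?m = "dyadic_level \<epsilon>"
  note m = dyadic_level_bounds[OF \<epsilon>]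
  have "graph_packing f \<epsilon> \<le> 2 * (2 ^ ?m * (dyadic_osc ?m f + 1))"
    by (rule packing_number_upper[OF cont(1) m(1)])
  also have "\<dots> \<le> 2 * (2 ^ ?m * (dyadic_osc ?m g + 1) + 2 ^ ?m * (dyadic_osc ?m h + 1))"
    using dyadic_osc_triangle[OF cont(2,3) tri, of ?m]
    by (simp add: distrib_left[symmetric])
  also have "\<dots> \<le> 2 * (306 * graph_packing g \<epsilon> + 306 * graph_packing h \<epsilon>)"
    using packing_number_lower[OF cont(2) m] packing_number_lower[OF cont(3) m] by simp
  finally show ?thesis by simp
qed

text \<open>A sum is at most twice the maximum, which doubles 612 to 1224. The logarithm commutes
  with \<open>max\<close> and turns the constant into an additive error that vanishes as \<epsilon>
  tends to 0.\<close>

lemma packing_exponent_triangle: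
  assumes cont: "continuous_on {0..1} f" "continuous_on {0..1} g" "continuous_on {0..1} h"
    and tri: "\<And>s t. \<lbrakk>s \<in> {0..1}; t \<in> {0..1}\<rbrakk> \<Longrightarrow> \<bar>f s - f t\<bar> \<le> \<bar>g s - g t\<bar> + \<bar>h s - h t\<bar>"
    and \<epsilon>: "0 < \<epsilon>" "\<epsilon> < 1"
  shows "packing_exponent f \<epsilon> \<le>
    max (packing_exponent g \<epsilon>) (packing_exponent h \<epsilon>) + ln 1224 / ln (inverse \<epsilon>)"
proof -
  let ?M = "max (graph_packing g \<epsilon>) (graph_packing h \<epsilon>)"
  have pos: "1 \<le> graph_packing f \<epsilon>" "1 \<le> graph_packing g \<epsilon>" "1 \<le> graph_packing h \<epsilon>"
    using graph_packing_pos[OF cont(1)] graph_packing_pos[OF cont(2)] graph_packing_pos[OF cont(3)] \<epsilon>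
    by (simp_all only: less_imp_le)
  have L: "0 < ln (inverse \<epsilon>)" using \<epsilon> by (simp add: one_less_inverse_iff)
  have "graph_packing f \<epsilon> \<le> 1224 * ?M"
    using graph_packing_triangle[OF cont tri, of \<epsilon>] \<epsilon> by simp
  then have "ln (graph_packing f \<epsilon>) \<le> ln (1224 * ?M)" using pos by (intro ln_mono) auto
  also have "\<dots> = ln 1224 + ln ?M" using pos by (subst ln_mult) auto
  also have "ln ?M = max (ln (graph_packing g \<epsilon>)) (ln (graph_packing h \<epsilon>))"
    using pos by (auto simp: max_def)
  finally have "packing_exponent f \<epsilon> \<le>
      (ln 1224 + max (ln (graph_packing g \<epsilon>)) (ln (graph_packing h \<epsilon>))) / ln (inverse \<epsilon>)"
    unfolding packing_exponent_def using L by (intro divide_right_mono) auto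
  also have "\<dots> = max (packing_exponent g \<epsilon>) (packing_exponent h \<epsilon>) + ln 1224 / ln (inverse \<epsilon>)"
    using L by (auto simp: packing_exponent_def max_def add_divide_distrib divide_le_cancel)
  finally show ?thesis .
qed

section \<open>From growth of the oscillation sum to limits of packing exponents\<close>

lemma const_over_log_tendsto_0: "((\<lambda>\<epsilon>. c / ln (inverse \<epsilon>)) \<longlongrightarrow> 0) (at_right (0 :: real))"
proof -
  have "filterlim (\<lambda>\<epsilon>. ln (inverse \<epsilon>)) at_top (at_right (0 :: real))"
    using filterlim_compose[OF ln_at_top filterlim_inverse_at_top_right] .
  then show ?thesis
    by (intro tendsto_divide_0[OF tendsto_const] filterlim_at_top_imp_at_infinity)
qed

text \<open>Since \<open>inverse \<epsilon> \<le> 2 ^ m\<close> at the level of \<epsilon>, taking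
  logarithms gives the exponent \<open>s\<close> up to
  \<open>ln (c / 306) / ln (inverse \<epsilon>)\<close>, and this error eventually fits into the gap
  between \<open>u\<close> and \<open>s\<close>.\<close>

lemma eventually_packing_exponent_ge:
  assumes h: "continuous_on {0..1} h" and s: "0 \<le> s" and c: "0 < c"
    and osc: "\<forall>\<^sub>F m in sequentially. c * (2 ^ m) powr s \<le> 2 ^ m * (dyadic_osc m h + 1)"
    and u: "u < s"
  shows "\<forall>\<^sub>F \<epsilon> in at_right 0. u < packing_exponent h \<epsilon>"
proof -
  have "\<forall>\<^sub>F \<epsilon> in at_right 0. u - s < ln (c / 306) / ln (inverse (\<epsilon> :: real))"
    using order_tendstoD(1)[OF const_over_log_tendsto_0, of "u - s" "ln (c / 306)"] u by simp
  moreover have "\<forall>\<^sub>F \<epsilon> in at_right 0. c * (2 ^ dyadic_level \<epsilon>) powr s \<le>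
      2 ^ dyadic_level \<epsilon> * (dyadic_osc (dyadic_level \<epsilon>) h + 1)"
    using eventually_compose_filterlim[OF osc filterlim_dyadic_level] .
  ultimately show ?thesis using eventually_at_right_0_unit
  proof eventually_elim
    case (elim \<epsilon>)
    let ?m = "dyadic_level \<epsilon>"
    have \<epsilon>: "0 < \<epsilon>" "\<epsilon> \<le> 1" using elim by auto
    note m = dyadic_level_bounds[OF \<epsilon>]
    have L: "0 < ln (inverse \<epsilon>)" using elim by (simp add: one_less_inverse_iff)
    have "inverse \<epsilon> \<le> 2 ^ ?m" using m(1) \<epsilon> by (simp add: field_simps)
    then have "c * inverse \<epsilon> powr s \<le> c * (2 ^ ?m) powr s"
      using c s \<epsilon> by (intro mult_left_mono powr_mono2) auto
    also have "\<dots> \<le> 306 * graph_packing h \<epsilon>"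
      using elim(2) packing_number_lower[OF h m] by linarith
    finally have "c / 306 * inverse \<epsilon> powr s \<le> graph_packing h \<epsilon>" by simp
    then have "ln (c / 306 * inverse \<epsilon> powr s) \<le> ln (graph_packing h \<epsilon>)"
      using c \<epsilon> by (intro ln_mono) auto
    moreover have "ln (c / 306 * inverse \<epsilon> powr s) = ln (c / 306) + s * ln (inverse \<epsilon>)"
      using c \<epsilon> by (subst ln_mult) (auto simp: ln_powr)
    ultimately have "(ln (c / 306) + s * ln (inverse \<epsilon>)) / ln (inverse \<epsilon>) \<le> packing_exponent h \<epsilon>"
      unfolding packing_exponent_def using L by (intro divide_right_mono) auto
    then show ?case using elim(1) L by (simp add: add_divide_distrib)
  qed
qed

lemma eventually_packing_exponent_le:
  assumes h: "continuous_on {0..1} h" and s: "0 \<le> s" and c: "0 < c"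
    and osc: "\<forall>\<^sub>F m in sequentially. 2 ^ m * (dyadic_osc m h + 1) \<le> c * (2 ^ m) powr s"
    and u: "s < u"
  shows "\<forall>\<^sub>F \<epsilon> in at_right 0. packing_exponent h \<epsilon> < u"
proof -
  \<comment> \<open>The 2 comes from \<open>packing_number_upper\<close>, and
    \<open>4 powr s\<close> from \<open>2 ^ m \<le> 4 * inverse \<epsilon>\<close>.\<close>
  define C where "C = 2 * c * 4 powr s"
  have C: "0 < C" using c by (simp add: C_def)
  have "\<forall>\<^sub>F \<epsilon> in at_right 0. ln C / ln (inverse (\<epsilon> :: real)) < u - s"
    using order_tendstoD(2)[OF const_over_log_tendsto_0, of "u - s" "ln C"] u by simp
  moreover have "\<forall>\<^sub>F \<epsilon> in at_right 0. 2 ^ dyadic_level \<epsilon> * (dyadic_osc (dyadic_level \<epsilon>) h + 1) \<le>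
      c * (2 ^ dyadic_level \<epsilon>) powr s"
    using eventually_compose_filterlim[OF osc filterlim_dyadic_level] .
  ultimately show ?thesis using eventually_at_right_0_unit
  proof eventually_elim
    case (elim \<epsilon>)
    let ?m = "dyadic_level \<epsilon>"
    have \<epsilon>: "0 < \<epsilon>" "\<epsilon> \<le> 1" using elim by auto
    note m = dyadic_level_bounds[OF \<epsilon>]
    have L: "0 < ln (inverse \<epsilon>)" using elim by (simp add: one_less_inverse_iff)
    have "2 ^ ?m \<le> 4 * inverse \<epsilon>" using m(2) \<epsilon> by (simp add: field_simps)
    then have "(2 ^ ?m) powr s \<le> (4 * inverse \<epsilon>) powr s" using s by (intro powr_mono2) auto
    then have "2 * c * (2 ^ ?m) powr s \<le> C * inverse \<epsilon> powr s"
      using c \<epsilon> by (simp add: C_def powr_mult)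
    then have "graph_packing h \<epsilon> \<le> C * inverse \<epsilon> powr s"
      using elim(2) packing_number_upper[OF h m(1)] by linarith
    then have "ln (graph_packing h \<epsilon>) \<le> ln (C * inverse \<epsilon> powr s)"
      using graph_packing_pos[OF h \<epsilon>] by (intro ln_mono) auto
    also have "\<dots> = ln C + s * ln (inverse \<epsilon>)"
      using C \<epsilon> by (subst ln_mult) (auto simp: ln_powr)
    finally have "packing_exponent h \<epsilon> \<le> (ln C + s * ln (inverse \<epsilon>)) / ln (inverse \<epsilon>)"
      unfolding packing_exponent_def using L by (intro divide_right_mono) auto
    then show ?case using elim(1) L by (simp add: add_divide_distrib)
  qed
qed

section \<open>Limits inferior and superior under null perturbations and truncation\<close>

lemma Liminf_Limsup_diff_tendsto_0:
  fixes X Y :: "'b \<Rightarrow> real"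
  assumes "F \<noteq> bot" "((\<lambda>x. X x - Y x) \<longlongrightarrow> 0) F"
  shows "Liminf F (\<lambda>x. ereal (X x)) = Liminf F (\<lambda>x. ereal (Y x))"
    and "Limsup F (\<lambda>x. ereal (X x)) = Limsup F (\<lambda>x. ereal (Y x))"
proof -
  \<comment> \<open>One-sided and for an arbitrary pair, so that it can be used in both directions:
    eventually \<open>U \<le> V + e\<close> for each \<open>e > 0\<close>, and adding a real
    constant commutes with both limits.\<close>
  have le: "Liminf F (\<lambda>x. ereal (U x)) \<le> Liminf F (\<lambda>x. ereal (V x))"
    "Limsup F (\<lambda>x. ereal (U x)) \<le> Limsup F (\<lambda>x. ereal (V x))"
    if lim: "((\<lambda>x. U x - V x) \<longlongrightarrow> 0) F" for U V :: "'b \<Rightarrow> real"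
  proof -
    have ev: "\<forall>\<^sub>F x in F. ereal (U x) \<le> ereal (V x) + ereal e" if "0 < e" for e
      using order_tendstoD(2)[OF lim that] by (rule eventually_mono) simp
    show "Liminf F (\<lambda>x. ereal (U x)) \<le> Liminf F (\<lambda>x. ereal (V x))"
    proof (rule ereal_le_epsilon2)
      fix e :: real assume "0 < e"
      then show "Liminf F (\<lambda>x. ereal (U x)) \<le> Liminf F (\<lambda>x. ereal (V x)) + ereal e"
        using Liminf_mono[OF ev, of e] assms(1) by (simp add: Liminf_add_ereal_right del: plus_ereal.simps)
    qed
    show "Limsup F (\<lambda>x. ereal (U x)) \<le> Limsup F (\<lambda>x. ereal (V x))"
    proof (rule ereal_le_epsilon2)
      fix e :: real assume "0 < e"
      then show "Limsup F (\<lambda>x. ereal (U x)) \<le> Limsup F (\<lambda>x. ereal (V x)) + ereal e"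
        using Limsup_mono[OF ev, of e] assms(1) by (simp add: Limsup_add_ereal_right del: plus_ereal.simps)
    qed
  qed
  have "((\<lambda>x. Y x - X x) \<longlongrightarrow> 0) F" using tendsto_minus[OF assms(2)] by simp
  then show "Liminf F (\<lambda>x. ereal (X x)) = Liminf F (\<lambda>x. ereal (Y x))"
    "Limsup F (\<lambda>x. ereal (X x)) = Limsup F (\<lambda>x. ereal (Y x))"
    using le assms(2) by (auto intro: antisym)
qed

text \<open>Truncation from below is monotone and continuous on the extended reals, so it commutes
  with both limits.\<close>

lemma Liminf_Limsup_max_const:
  fixes X :: "'b \<Rightarrow> real"
  assumes "F \<noteq> bot"
  shows "Liminf F (\<lambda>x. ereal (max c (X x))) = max (ereal c) (Liminf F (\<lambda>x. ereal (X x)))"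
    and "Limsup F (\<lambda>x. ereal (max c (X x))) = max (ereal c) (Limsup F (\<lambda>x. ereal (X x)))"
proof -
  have "mono (max (ereal c))" by (auto simp: mono_def max_def)
  moreover have "continuous_on UNIV (max (ereal c))" by (intro continuous_intros)
  ultimately show "Liminf F (\<lambda>x. ereal (max c (X x))) = max (ereal c) (Liminf F (\<lambda>x. ereal (X x)))"
    "Limsup F (\<lambda>x. ereal (max c (X x))) = max (ereal c) (Limsup F (\<lambda>x. ereal (X x)))"
    using assms Liminf_compose_continuous_mono[of "max (ereal c)" F "\<lambda>x. ereal (X x)"]
      Limsup_compose_continuous_mono[of "max (ereal c)" F "\<lambda>x. ereal (X x)"]
    by (simp_all add: ereal_max)
qed

text \<open>The deterministic core, to be applied to a single path \<open>g\<close>. The triangle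
  bounds, with the exponent of \<open>g\<close> replaced by its limit \<open>c\<close>, show that
  the truncated exponents of \<open>g + f\<close> and \<open>f\<close> have the same limits. By
  \<open>low\<close> the truncation does not change the limits for \<open>g + f\<close>, while for
  \<open>f\<close> it remains as the maximum with \<open>c\<close>.\<close>

lemma minkowski_dim_graph_add:
  assumes g: "continuous_on {0..1} g" and f: "continuous_on {0..1} f"
    and lim: "(packing_exponent g \<longlongrightarrow> c) (at_right 0)"
    and low: "\<And>u. u < c \<Longrightarrow> \<forall>\<^sub>F \<epsilon> in at_right 0. u < packing_exponent (\<lambda>t. g t + f t) \<epsilon>"
  shows "lower_minkowski_dim (graph_over {0..1} (\<lambda>t. g t + f t)) =
        max (lower_minkowski_dim (graph_over {0..1} g)) (lower_minkowski_dim (graph_over {0..1} f))"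
    and "upper_minkowski_dim (graph_over {0..1} (\<lambda>t. g t + f t)) =
        max (lower_minkowski_dim (graph_over {0..1} g)) (upper_minkowski_dim (graph_over {0..1} f))"
proof -
  define p where "p = packing_exponent g"
  define d where "d = packing_exponent (\<lambda>t. g t + f t)"
  define e where "e = packing_exponent f"
  let ?F = "at_right (0 :: real)"
  have dims: "lower_minkowski_dim (graph_over {0..1} h) = Liminf ?F (\<lambda>\<epsilon>. ereal (packing_exponent h \<epsilon>))"
    "upper_minkowski_dim (graph_over {0..1} h) = Limsup ?F (\<lambda>\<epsilon>. ereal (packing_exponent h \<epsilon>))" for h
    by (simp_all add: lower_minkowski_dim_def upper_minkowski_dim_def packing_exponent_def)
  have gf: "continuous_on {0..1} (\<lambda>t. g t + f t)" using g f by (intro continuous_intros)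
  have "\<forall>\<^sub>F \<epsilon> in ?F. norm (max c (d \<epsilon>) - max c (e \<epsilon>)) \<le> \<bar>p \<epsilon> - c\<bar> + ln 1224 / ln (inverse \<epsilon>)"
    using eventually_at_right_0_unit
  proof (rule eventually_mono)
    fix \<epsilon> :: real assume \<epsilon>: "0 < \<epsilon> \<and> \<epsilon> < 1"
    define \<theta> where "\<theta> = ln 1224 / ln (inverse \<epsilon>)"
    have "0 \<le> \<theta>" using \<epsilon> by (simp add: \<theta>_def one_less_inverse_iff less_imp_le)
    moreover have "d \<epsilon> \<le> max (p \<epsilon>) (e \<epsilon>) + \<theta>"
      unfolding d_def e_def p_def \<theta>_def using g f gf \<epsilon> by (intro packing_exponent_triangle) auto
    \<comment> \<open>The reverse direction: an increment of \<open>f\<close> is the difference of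
      those of \<open>g + f\<close> and \<open>g\<close>.\<close>
    moreover have "e \<epsilon> \<le> max (d \<epsilon>) (p \<epsilon>) + \<theta>"
      unfolding d_def e_def p_def \<theta>_def using g f gf \<epsilon> by (intro packing_exponent_triangle) auto
    moreover have "max (p \<epsilon>) (e \<epsilon>) \<le> max c (e \<epsilon>) + \<bar>p \<epsilon> - c\<bar>"
      "max (d \<epsilon>) (p \<epsilon>) \<le> max c (d \<epsilon>) + \<bar>p \<epsilon> - c\<bar>" by linarith+
    ultimately have "max c (d \<epsilon>) \<le> max c (e \<epsilon>) + (\<bar>p \<epsilon> - c\<bar> + \<theta>)"
      "max c (e \<epsilon>) \<le> max c (d \<epsilon>) + (\<bar>p \<epsilon> - c\<bar> + \<theta>)" by linarith+
    then show "norm (max c (d \<epsilon>) - max c (e \<epsilon>)) \<le> \<bar>p \<epsilon> - c\<bar> + ln 1224 / ln (inverse \<epsilon>)"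
      unfolding real_norm_def \<theta>_def abs_le_iff by (simp add: algebra_simps)
  qed
  moreover have "((\<lambda>\<epsilon>. \<bar>p \<epsilon> - c\<bar> + ln 1224 / ln (inverse \<epsilon>)) \<longlongrightarrow> 0) ?F"
    using lim unfolding p_def
    by (intro tendsto_add_zero const_over_log_tendsto_0 tendsto_rabs_zero) (simp add: LIM_zero)
  ultimately have diff: "((\<lambda>\<epsilon>. max c (d \<epsilon>) - max c (e \<epsilon>)) \<longlongrightarrow> 0) ?F"
    by (rule Lim_null_comparison)
  have lowd: "ereal c \<le> Liminf ?F (\<lambda>\<epsilon>. ereal (d \<epsilon>))"
    unfolding le_Liminf_iff
  proof (intro allI impI)
    fix y assume y: "y < ereal c"
    then obtain u where u: "y < ereal u" "u < c" using ereal_dense2[of y "ereal c"] by auto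
    from low[OF u(2)] show "\<forall>\<^sub>F \<epsilon> in ?F. y < ereal (d \<epsilon>)"
      unfolding d_def by (rule eventually_mono) (use u in \<open>auto intro: less_trans\<close>)
  qed
  have lowd': "ereal c \<le> Limsup ?F (\<lambda>\<epsilon>. ereal (d \<epsilon>))"
    using lowd Liminf_le_Limsup[of ?F "\<lambda>\<epsilon>. ereal (d \<epsilon>)"] by (auto intro: order_trans)
  have c: "lower_minkowski_dim (graph_over {0..1} g) = ereal c"
    unfolding dims using lim by (intro lim_imp_Liminf) auto
  have bot: "?F \<noteq> bot" by simp
  note eqs = Liminf_Limsup_diff_tendsto_0[OF bot diff, unfolded Liminf_Limsup_max_const[OF bot]]
  show "lower_minkowski_dim (graph_over {0..1} (\<lambda>t. g t + f t)) =
        max (lower_minkowski_dim (graph_over {0..1} g)) (lower_minkowski_dim (graph_over {0..1} f))"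
    unfolding c unfolding dims e_def[symmetric] d_def[symmetric] eqs(1)[symmetric]
    using lowd by (simp add: max_def)
  show "upper_minkowski_dim (graph_over {0..1} (\<lambda>t. g t + f t)) =
        max (lower_minkowski_dim (graph_over {0..1} g)) (upper_minkowski_dim (graph_over {0..1} f))"
    unfolding c unfolding dims e_def[symmetric] d_def[symmetric] eqs(2)[symmetric]
    using lowd' by (simp add: max_def)
qed

section \<open>Gaussian estimates\<close>

text \<open>The density is at most \<open>1 / (2 * \<sigma>)\<close> because
  \<open>2 * pi \<ge> 4\<close>, and the interval has length \<open>2 * r\<close>. The shift only
  moves the interval, so it does not enter the bound.\<close>

lemma (in prob_space) prob_normal_interval_le:
  assumes X: "distributed M lborel X (normal_density \<mu> \<sigma>)" and "0 < \<sigma>" "0 \<le> r"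
  shows "prob {\<omega> \<in> space M. \<bar>X \<omega> + a\<bar> < r} \<le> r / \<sigma>"
proof -
  have le: "normal_density \<mu> \<sigma> x \<le> 1 / (2 * \<sigma>)" for x
  proof -
    have "normal_density \<mu> \<sigma> x \<le> 1 / sqrt (2 * pi * \<sigma>\<^sup>2)"
      using assms by (auto simp: normal_density_def intro!: divide_right_mono)
    also have "2 * \<sigma> \<le> sqrt (2 * pi * \<sigma>\<^sup>2)"
      using assms pi_gt3 by (intro real_le_rsqrt) (auto simp: power2_eq_square)
    then have "1 / sqrt (2 * pi * \<sigma>\<^sup>2) \<le> 1 / (2 * \<sigma>)"
      using assms by (intro divide_left_mono) auto
    finally show ?thesis .
  qed
  have "X -` {- a - r<..<- a + r} \<inter> space M = {\<omega> \<in> space M. \<bar>X \<omega> + a\<bar> < r}" by auto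
  then have "emeasure M {\<omega> \<in> space M. \<bar>X \<omega> + a\<bar> < r} =
      (\<integral>\<^sup>+x. ennreal (normal_density \<mu> \<sigma> x) * indicator {- a - r<..<- a + r} x \<partial>lborel)"
    using distributed_emeasure[OF X, of "{- a - r<..<- a + r}"] by simp
  also have "\<dots> \<le> (\<integral>\<^sup>+x. ennreal (1 / (2 * \<sigma>)) * indicator {- a - r<..<- a + r} x \<partial>lborel)"
    by (intro nn_integral_mono mult_right_mono ennreal_leI le) auto
  also have "\<dots> = ennreal (1 / (2 * \<sigma>)) * ennreal (2 * r)"
    using assms by (simp add: nn_integral_cmult_indicator)
  also have "\<dots> = ennreal (r / \<sigma>)" using assms by (simp add: ennreal_mult[symmetric])
  finally show ?thesis using assms by (simp add: emeasure_eq_measure)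
qed

text \<open>Markov's inequality for the moment of order \<open>2 * q\<close>.\<close>

lemma (in prob_space) prob_normal_tail_le:
  assumes X: "distributed M lborel X (normal_density 0 \<sigma>)" and "0 < \<sigma>" "0 < r"
  shows "prob {\<omega> \<in> space M. r \<le> \<bar>X \<omega>\<bar>} \<le> fact (2 * q) / (2 ^ q * fact q) * (\<sigma> / r) ^ (2 * q)"
proof -
  have [measurable]: "random_variable borel X" using distributed_measurable[OF X] by simp
  have "has_bochner_integral lborel (\<lambda>x. normal_density 0 \<sigma> x * (x - 0) ^ (2 * q))
      (fact (2 * q) / ((2 / \<sigma>\<^sup>2) ^ q * fact q))"
    using \<open>0 < \<sigma>\<close> by (rule normal_moment_even)
  then have int: "integrable lborel (\<lambda>x. normal_density 0 \<sigma> x * x ^ (2 * q))"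
    and val: "(\<integral>x. normal_density 0 \<sigma> x * x ^ (2 * q) \<partial>lborel) =
      fact (2 * q) / ((2 / \<sigma>\<^sup>2) ^ q * fact q)"
    by (auto simp: has_bochner_integral_iff)
  have E: "integrable M (\<lambda>\<omega>. X \<omega> ^ (2 * q))"
    using distributed_integrable[OF X, of "\<lambda>x. x ^ (2 * q)"] int by simp
  have V: "(\<integral>\<omega>. X \<omega> ^ (2 * q) \<partial>M) = fact (2 * q) / ((2 / \<sigma>\<^sup>2) ^ q * fact q)"
    using distributed_integral[OF X, of "\<lambda>x. x ^ (2 * q)"] val by simp
  have "{\<omega> \<in> space M. r \<le> \<bar>X \<omega>\<bar>} \<subseteq> {\<omega> \<in> space M. r ^ (2 * q) \<le> X \<omega> ^ (2 * q)}"
    using \<open>0 < r\<close> power_mono[of r "\<bar>X _\<bar>" "2 * q"] by (auto simp: power_even_abs)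
  then have "prob {\<omega> \<in> space M. r \<le> \<bar>X \<omega>\<bar>} \<le> prob {\<omega> \<in> space M. r ^ (2 * q) \<le> X \<omega> ^ (2 * q)}"
    by (rule finite_measure_mono) measurable
  also have "\<dots> \<le> (\<integral>\<omega>. X \<omega> ^ (2 * q) \<partial>M) / r ^ (2 * q)"
    using E \<open>0 < r\<close> by (intro integral_Markov_inequality_measure[where A = "{}"]) auto
  also have "\<dots> = fact (2 * q) / (2 ^ q * fact q) * (\<sigma> / r) ^ (2 * q)"
    unfolding V by (simp add: power_divide power_mult)
  finally show ?thesis .
qed

text \<open>With \<open>n = card I\<close>, the mean number of successes is at least
  \<open>n / 2\<close>, so the event is a deviation by at least \<open>n / 4\<close>. Hoeffding's
  exponent is then \<open>- 2 * (n / 4)\<^sup>2 / n = - n / 8\<close>.\<close>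

lemma (in prob_space) prob_few_successes_le:
  assumes I: "finite I" "I \<noteq> {}"
    and ind: "indep_vars (\<lambda>_. borel) X I"
    and A: "\<And>i. i \<in> I \<Longrightarrow> A i \<in> sets borel"
    and half: "\<And>i. i \<in> I \<Longrightarrow> 1 / 2 \<le> prob {\<omega> \<in> space M. X i \<omega> \<in> A i}"
  shows "prob {\<omega> \<in> space M. (\<Sum>i\<in>I. indicator (A i) (X i \<omega>)) \<le> real (card I) / 4}
    \<le> exp (- real (card I) / 8)"
proof -
  have ind': "indep_vars (\<lambda>_. borel) (\<lambda>i \<omega>. indicator (A i) (X i \<omega>) :: real) I"
    using ind by (rule indep_vars_compose2) (use A in simp)
  have rv: "random_variable borel (X i)" if "i \<in> I" for i
    using ind that by (auto simp: indep_vars_def)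
  define \<mu> where "\<mu> = (\<Sum>i\<in>I. expectation (\<lambda>\<omega>. indicator (A i) (X i \<omega>) :: real))"
  interpret Hoeffding_ineq M I "\<lambda>i \<omega>. indicator (A i) (X i \<omega>)" "\<lambda>_. 0" "\<lambda>_. 1" \<mu>
    by unfold_locales (auto simp: I ind' \<mu>_def split: split_indicator)
  have "expectation (\<lambda>\<omega>. indicator (A i) (X i \<omega>) :: real) \<ge> 1 / 2" if i: "i \<in> I" for i
  proof -
    have "{\<omega> \<in> space M. X i \<omega> \<in> A i} \<in> events"
      using measurable_sets[OF rv[OF i] A[OF i]] by (simp add: vimage_def Int_def conj_commute)
    moreover have "expectation (\<lambda>\<omega>. indicator (A i) (X i \<omega>) :: real) =
        expectation (indicator {\<omega> \<in> space M. X i \<omega> \<in> A i})"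
      by (rule Bochner_Integration.integral_cong) (auto split: split_indicator)
    ultimately show ?thesis using half[OF i] by simp
  qed
  then have "(\<Sum>i\<in>I. 1 / 2) \<le> \<mu>" unfolding \<mu>_def by (intro sum_mono)
  then have \<mu>: "real (card I) / 2 \<le> \<mu>" by simp
  have pos: "real (card I) > 0" using I by (simp add: card_gt_0_iff)
  have "{\<omega> \<in> space M. (\<Sum>i\<in>I. indicator (A i) (X i \<omega>)) \<le> real (card I) / 4}
      \<subseteq> {\<omega> \<in> space M. (\<Sum>i\<in>I. indicator (A i) (X i \<omega>)) \<le> \<mu> - real (card I) / 4}"
    using \<mu> by auto
  then have "prob {\<omega> \<in> space M. (\<Sum>i\<in>I. indicator (A i) (X i \<omega>)) \<le> real (card I) / 4}
      \<le> prob {\<omega> \<in> space M. (\<Sum>i\<in>I. indicator (A i) (X i \<omega>)) \<le> \<mu> - real (card I) / 4}"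
    by (rule finite_measure_mono) measurable
  also have "\<dots> \<le> exp (-2 * (real (card I) / 4)\<^sup>2 / (\<Sum>i\<in>I. (1 - 0)\<^sup>2))"
    by (rule Hoeffding_ineq_le) (use pos in auto)
  also have "\<dots> = exp (- real (card I) / 8)"
    using pos by (simp add: power2_eq_square field_simps)
  finally show ?thesis .
qed

section \<open>Brownian paths\<close>

context standard_brownian_motion
begin

lemma dyadic_increment_distributed:
  "distributed M lborel (\<lambda>\<omega>. B (real (Suc k) / 2 ^ m) \<omega> - B (real k / 2 ^ m) \<omega>)
     (normal_density 0 (sqrt (1 / 2) ^ m))"
proof -
  have "real (Suc k) / 2 ^ m - real k / 2 ^ m = (1 / 2) ^ m"
    by (simp add: diff_divide_distrib[symmetric] power_one_over)
  then show ?thesis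
    using gaussian_increments[of "real k / 2 ^ m" "real (Suc k) / 2 ^ m"]
    by (simp add: divide_strict_right_mono real_sqrt_power)
qed

lemma dyadic_increments_indep:
  "indep_vars (\<lambda>_. borel) (\<lambda>k \<omega>. B (real (Suc k) / 2 ^ m) \<omega> - B (real k / 2 ^ m) \<omega>) {..<2 ^ m}"
  by (rule independent_increments[of "\<lambda>k. real k / 2 ^ m"]) (auto simp: divide_right_mono)

text \<open>A Gaussian of standard deviation \<open>\<sigma>\<close> shifted by any constant has absolute value at least
  \<open>\<sigma> / 2\<close> with probability at least \<open>1 / 2\<close>, whatever the shift.\<close>

lemma AE_shifted_dyadic_increments_large:
  fixes a :: "nat \<Rightarrow> nat \<Rightarrow> real"
  shows "AE \<omega> in M. eventually (\<lambda>m. 2 ^ m * sqrt (1 / 2) ^ m / 8 \<le>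
    (\<Sum>k<2 ^ m. \<bar>B (real (Suc k) / 2 ^ m) \<omega> - B (real k / 2 ^ m) \<omega> + a m k\<bar>)) sequentially"
proof -
  define X where "X m k \<omega> = B (real (Suc k) / 2 ^ m) \<omega> - B (real k / 2 ^ m) \<omega>" for m k \<omega>
  define \<sigma> :: "nat \<Rightarrow> real" where "\<sigma> m = sqrt (1 / 2) ^ m" for m
  define A where "A m k = {x. \<sigma> m / 2 \<le> \<bar>x + a m k\<bar>}" for m k
  \<comment> \<open>At most a quarter of the shifted increments reach \<open>\<sigma> m / 2\<close>.
    Off this event their sum is at least \<open>2 ^ m / 4 * (\<sigma> m / 2)\<close>, which explains
    the divisor 8 in the claim.\<close>
  define bad where
    "bad m = {\<omega> \<in> space M. (\<Sum>k<2 ^ m. indicator (A m k) (X m k \<omega>)) \<le> real (card {..<(2::nat) ^ m}) / 4}" for m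
  have \<sigma>: "\<sigma> m > 0" for m by (simp add: \<sigma>_def)
  have X: "distributed M lborel (X m k) (normal_density 0 (\<sigma> m))" for m k
    unfolding X_def \<sigma>_def by (rule dyadic_increment_distributed)
  have rv [measurable]: "random_variable borel (X m k)" for m k
    using distributed_measurable[OF X[of m k]] by simp
  have A [measurable]: "A m k \<in> sets borel" for m k
    unfolding A_def by measurable
  have bad [measurable]: "bad m \<in> events" for m
    unfolding bad_def by measurable
  have "prob (bad m) \<le> exp (- real (card {..<(2::nat) ^ m}) / 8)" for m
    unfolding bad_def
  proof (rule prob_few_successes_le)
    show "indep_vars (\<lambda>_. borel) (X m) {..<2 ^ m}"
      unfolding X_def by (rule dyadic_increments_indep)
    fix k
    have "prob {\<omega> \<in> space M. \<bar>X m k \<omega> + a m k\<bar> < \<sigma> m / 2} \<le> \<sigma> m / 2 / \<sigma> m"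
      using X \<sigma>[of m] by (intro prob_normal_interval_le) auto
    then have "prob {\<omega> \<in> space M. \<bar>X m k \<omega> + a m k\<bar> < \<sigma> m / 2} \<le> 1 / 2"
      using \<sigma>[of m] by simp
    moreover have "{\<omega> \<in> space M. X m k \<omega> \<in> A m k} =
        space M - {\<omega> \<in> space M. \<bar>X m k \<omega> + a m k\<bar> < \<sigma> m / 2}"
      by (auto simp: A_def)
    moreover have "prob (space M - {\<omega> \<in> space M. \<bar>X m k \<omega> + a m k\<bar> < \<sigma> m / 2}) =
        1 - prob {\<omega> \<in> space M. \<bar>X m k \<omega> + a m k\<bar> < \<sigma> m / 2}"
      by (rule prob_compl) measurable
    ultimately show "1 / 2 \<le> prob {\<omega> \<in> space M. X m k \<omega> \<in> A m k}" by simp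
    show "{..<(2::nat) ^ m} \<noteq> {}" by (metis emptyE lessThan_iff zero_less_power zero_less_numeral)
  qed (auto simp: A)
  \<comment> \<open>The crude bound \<open>x \<le> exp x\<close> already leaves a summable series
    for Borel-Cantelli.\<close>
  moreover have "exp (- real (card {..<(2::nat) ^ m}) / 8) \<le> 8 * (1 / 2) ^ m" for m
  proof -
    have "2 ^ m / 8 \<le> exp (2 ^ m / 8 :: real)" using exp_ge_add_one_self[of "2 ^ m / 8 :: real"] by linarith
    then have "inverse (exp (2 ^ m / 8 :: real)) \<le> inverse (2 ^ m / 8)"
      by (intro le_imp_inverse_le) auto
    then show ?thesis by (simp add: exp_minus power_one_over field_simps)
  qed
  ultimately have "prob (bad m) \<le> 8 * (1 / 2) ^ m" for m
    using order_trans by blast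
  then have "summable (\<lambda>m. prob (bad m))"
    by - (rule summable_comparison_test'[where g = "\<lambda>m. 8 * (1 / 2) ^ m" and N = 0], auto intro!: summable_mult)
  then have "AE \<omega> in M. eventually (\<lambda>m. \<omega> \<in> space M - bad m) sequentially"
    by (intro borel_cantelli_AE1) (auto simp: emeasure_eq_measure)
  then show ?thesis
  proof (rule eventually_mono)
    fix \<omega> assume "eventually (\<lambda>m. \<omega> \<in> space M - bad m) sequentially"
    then show "eventually (\<lambda>m. 2 ^ m * sqrt (1 / 2) ^ m / 8 \<le>
      (\<Sum>k<2 ^ m. \<bar>B (real (Suc k) / 2 ^ m) \<omega> - B (real k / 2 ^ m) \<omega> + a m k\<bar>)) sequentially"
    proof (rule eventually_mono)
      fix m assume "\<omega> \<in> space M - bad m"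
      then have "2 ^ m / 4 \<le> (\<Sum>k<2 ^ m. indicator (A m k) (X m k \<omega>) :: real)"
        by (auto simp: bad_def)
      then have "2 ^ m / 4 * (\<sigma> m / 2) \<le> (\<Sum>k<2 ^ m. indicator (A m k) (X m k \<omega>)) * (\<sigma> m / 2)"
        using \<sigma>[of m] by (intro mult_right_mono) auto
      also have "\<dots> \<le> (\<Sum>k<2 ^ m. \<bar>X m k \<omega> + a m k\<bar>)"
        unfolding sum_distrib_right by (intro sum_mono) (auto simp: A_def split: split_indicator)
      finally show "2 ^ m * sqrt (1 / 2) ^ m / 8 \<le>
        (\<Sum>k<2 ^ m. \<bar>B (real (Suc k) / 2 ^ m) \<omega> - B (real k / 2 ^ m) \<omega> + a m k\<bar>)"
        by (simp add: \<sigma>_def X_def)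
    qed
  qed
qed

text \<open>With \<open>r = 2 powr (1 / q - 1 / 2)\<close>, the standard deviation at level
  \<open>m\<close> divided by \<open>r ^ m\<close> is 2 to the power \<open>- m / q\<close>. The
  moment of order \<open>2 * q\<close> turns this into \<open>(1 / 4) ^ m\<close>, and a union bound
  over \<open>2 ^ m\<close> increments leaves the summable \<open>(1 / 2) ^ m\<close>.\<close>

lemma AE_dyadic_increments_small:
  assumes "0 < q"
  shows "AE \<omega> in M. eventually (\<lambda>m. \<forall>k<2 ^ m.
    \<bar>B (real (Suc k) / 2 ^ m) \<omega> - B (real k / 2 ^ m) \<omega>\<bar> \<le> (2 powr (1 / real q - 1 / 2)) ^ m) sequentially"
proof -
  define X where "X m k \<omega> = B (real (Suc k) / 2 ^ m) \<omega> - B (real k / 2 ^ m) \<omega>" for m k \<omega>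
  define r :: real where "r = 2 powr (1 / real q - 1 / 2)"
  define C :: real where "C = fact (2 * q) / (2 ^ q * fact q)"
  define bad where "bad m = (\<Union>k<2 ^ m. {\<omega> \<in> space M. r ^ m \<le> \<bar>X m k \<omega>\<bar>})" for m
  have X: "distributed M lborel (X m k) (normal_density 0 (sqrt (1 / 2) ^ m))" for m k
    unfolding X_def by (rule dyadic_increment_distributed)
  have rv [measurable]: "random_variable borel (X m k)" for m k
    using distributed_measurable[OF X[of m k]] by simp
  have [measurable]: "bad m \<in> events" for m
    unfolding bad_def by measurable
  have "sqrt (1 / 2) / r = 2 powr (- 1 / real q)"
  proof -
    have "sqrt (1 / 2) = 2 powr (- 1 / 2)"
      by (simp add: powr_half_sqrt[symmetric] powr_divide powr_minus_divide)
    then show ?thesis by (simp add: r_def powr_diff[symmetric])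
  qed
  then have "(sqrt (1 / 2) / r) ^ (2 * q) = 2 powr (- 2)"
    using assms by (simp add: powr_power)
  then have ratio: "(sqrt (1 / 2) ^ m / r ^ m) ^ (2 * q) = (1 / 4) ^ m" for m
    by (simp add: power_divide[symmetric] power_mult[symmetric] mult.commute[of m] powr_minus)
      (simp add: power_mult power_divide)
  have "prob (bad m) \<le> C * (1 / 2) ^ m" for m
  proof -
    have "prob (bad m) \<le> (\<Sum>k<2 ^ m. prob {\<omega> \<in> space M. r ^ m \<le> \<bar>X m k \<omega>\<bar>})"
      unfolding bad_def by (rule finite_measure_subadditive_finite) auto
    also have "\<dots> \<le> (\<Sum>k<(2::nat) ^ m. C * (sqrt (1 / 2) ^ m / r ^ m) ^ (2 * q))"
      unfolding C_def using X by (intro sum_mono prob_normal_tail_le) (auto simp: r_def)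
    also have "\<dots> = C * ((2 * (1 / 4)) ^ m)" unfolding ratio power_mult_distrib by simp
    finally show ?thesis by simp
  qed
  then have "summable (\<lambda>m. prob (bad m))"
    by - (rule summable_comparison_test'[where g = "\<lambda>m. C * (1 / 2) ^ m" and N = 0], auto intro!: summable_mult)
  then have "AE \<omega> in M. eventually (\<lambda>m. \<omega> \<in> space M - bad m) sequentially"
    by (intro borel_cantelli_AE1) (auto simp: emeasure_eq_measure)
  then show ?thesis
  proof (rule eventually_mono)
    fix \<omega> assume "eventually (\<lambda>m. \<omega> \<in> space M - bad m) sequentially"
    then show "eventually (\<lambda>m. \<forall>k<2 ^ m.
      \<bar>B (real (Suc k) / 2 ^ m) \<omega> - B (real k / 2 ^ m) \<omega>\<bar> \<le> (2 powr (1 / real q - 1 / 2)) ^ m) sequentially"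
    proof (rule eventually_mono)
      fix m assume "\<omega> \<in> space M - bad m"
      then have "\<not> r ^ m \<le> \<bar>X m k \<omega>\<bar>" if "k < 2 ^ m" for k
        using that by (auto simp: bad_def)
      then show "\<forall>k<2 ^ m.
        \<bar>B (real (Suc k) / 2 ^ m) \<omega> - B (real k / 2 ^ m) \<omega>\<bar> \<le> (2 powr (1 / real q - 1 / 2)) ^ m"
        unfolding X_def r_def using linorder_le_cases by blast
    qed
  qed
qed

text \<open>The increments of \<open>f\<close> enter as the shifts. The sum of increments is at
  least 2 to the power \<open>m / 2\<close>, up to the factor 8, and the further factor
  \<open>2 ^ m\<close> gives the exponent \<open>3 / 2\<close>. The null set arises before
  \<open>u\<close> is chosen, so one event serves all \<open>u\<close>.\<close>

lemma AE_packing_exponent_ge: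
  assumes f: "continuous_on {0..1} f"
  shows "AE \<omega> in M. \<forall>u<3 / 2. \<forall>\<^sub>F \<epsilon> in at_right 0. u < packing_exponent (\<lambda>t. B t \<omega> + f t) \<epsilon>"
  using continuous_paths
    AE_shifted_dyadic_increments_large[of "\<lambda>m k. f (real (Suc k) / 2 ^ m) - f (real k / 2 ^ m)"]
proof eventually_elim
  case (elim \<omega>)
  let ?h = "\<lambda>t. B t \<omega> + f t"
  have h: "continuous_on {0..1} ?h"
    using elim(1) f by (auto intro!: continuous_intros intro: continuous_on_subset)
  have "\<forall>\<^sub>F m in sequentially. 1 / 8 * (2 ^ m) powr (3 / 2) \<le> 2 ^ m * (dyadic_osc m ?h + 1)"
    using elim(2)
  proof eventually_elim
    case (elim m)
    have "(2 ^ m :: real) powr (3 / 2) = (2 ^ m) powr 1 * (2 ^ m) powr 1 * (2 ^ m) powr (- 1 / 2)"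
      unfolding powr_add[symmetric] by simp
    also have "(2 ^ m :: real) powr (- 1 / 2) = sqrt (1 / 2) ^ m"
      by (simp add: powr_minus powr_half_sqrt real_sqrt_power real_sqrt_divide power_one_over inverse_eq_divide)
    finally have "1 / 8 * (2 ^ m) powr (3 / 2) = 2 ^ m * (2 ^ m * sqrt (1 / 2) ^ m / 8)"
      by simp
    also have "\<dots> \<le> 2 ^ m * dyadic_osc m ?h"
      using elim sum_dyadic_increments_le_osc[OF h, of m]
      by (intro mult_left_mono) (auto simp: algebra_simps)
    also have "\<dots> \<le> 2 ^ m * (dyadic_osc m ?h + 1)" by (intro mult_left_mono) auto
    finally show ?case .
  qed
  from eventually_packing_exponent_ge[OF h _ _ this] show ?case by simp
qed

lemma AE_packing_exponent_le:
  "AE \<omega> in M. \<forall>u>3 / 2. \<forall>\<^sub>F \<epsilon> in at_right 0. packing_exponent (\<lambda>t. B t \<omega>) \<epsilon> < u"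
proof -
  \<comment> \<open>Countably many exponents \<open>q = 1 / (n + 3)\<close> suffice to serve all
    \<open>u\<close> on one event; the offset 3 keeps \<open>q < 1 / 2\<close>, so that the ratio
    \<open>r\<close> in the chaining is below 1.\<close>
  have "AE \<omega> in M. \<forall>n. eventually (\<lambda>m. \<forall>k<2 ^ m. \<bar>B (real (Suc k) / 2 ^ m) \<omega> - B (real k / 2 ^ m) \<omega>\<bar>
      \<le> (2 powr (1 / real (n + 3) - 1 / 2)) ^ m) sequentially"
    unfolding AE_all_countable by (intro allI AE_dyadic_increments_small) simp
  with continuous_paths show ?thesis
  proof eventually_elim
    case (elim \<omega>)
    let ?h = "\<lambda>t. B t \<omega>"
    have h: "continuous_on {0..1} ?h"
      using elim(1) by (rule continuous_on_subset) auto
    show ?case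
    proof (intro allI impI)
      fix u :: real assume "3 / 2 < u"
      then obtain n where n: "1 / real (Suc n) < u - 3 / 2"
        using nat_approx_posE[of "u - 3 / 2"] by auto
      define q where "q = 1 / real (n + 3)"
      define r :: real where "r = 2 powr (q - 1 / 2)"
      have q: "0 < q" "q < 1 / 2" "q < u - 3 / 2"
        using n frac_le[of 1 1 "real (Suc n)" "real (n + 3)"] by (auto simp: q_def)
      have r: "0 < r" "r < 1" "1 \<le> 2 * r"
      proof -
        show "0 < r" by (simp add: r_def)
        show "r < 1" using q powr_less_mono[of "q - 1 / 2" 0 2] by (simp add: r_def)
        have "2 powr (- 1) \<le> r" unfolding r_def using q by (intro powr_mono) auto
        then show "1 \<le> 2 * r" by (simp add: powr_minus)
      qed
      have "\<forall>\<^sub>F j in sequentially. \<forall>i<2 ^ j.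
          \<bar>B (real (Suc i) / 2 ^ j) \<omega> - B (real i / 2 ^ j) \<omega>\<bar> \<le> r ^ j"
        unfolding r_def q_def using elim(2) by (rule spec)
      then obtain m0 where m0: "\<forall>j\<ge>m0. \<forall>i<2 ^ j.
          \<bar>B (real (Suc i) / 2 ^ j) \<omega> - B (real i / 2 ^ j) \<omega>\<bar> \<le> r ^ j"
        unfolding eventually_sequentially by (rule exE)
      \<comment> \<open>\<open>2 / (1 - r)\<close> comes from the chaining bound; the added 1
        absorbs the summand 1 of \<open>dyadic_osc m ?h + 1\<close>, because
        \<open>1 \<le> 2 ^ m * r ^ m\<close>.\<close>
      define c where "c = 2 / (1 - r) + 1"
      have "\<forall>\<^sub>F m in sequentially. 2 ^ m * (dyadic_osc m ?h + 1) \<le> c * (2 ^ m) powr (3 / 2 + q)"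
        using eventually_ge_at_top[of m0]
      proof eventually_elim
        case (elim m)
        have "dyadic_osc m ?h \<le> 2 ^ m * (2 * r ^ m / (1 - r))"
        proof (rule dyadic_osc_le_chaining[OF h r(1,2)])
          fix j i :: nat assume "m \<le> j" "i < 2 ^ j"
          then show "\<bar>B (real (Suc i) / 2 ^ j) \<omega> - B (real i / 2 ^ j) \<omega>\<bar> \<le> r ^ j"
            using m0 order_trans[OF elim] by blast
        qed
        also have "\<dots> = 2 / (1 - r) * (2 ^ m * r ^ m)" by simp
        finally have "dyadic_osc m ?h + 1 \<le> 2 / (1 - r) * (2 ^ m * r ^ m) + 1" by simp
        moreover have "1 \<le> 2 ^ m * r ^ m"
          unfolding power_mult_distrib[symmetric] using r(3) by (rule one_le_power)
        moreover have "2 / (1 - r) * (2 ^ m * r ^ m) + 2 ^ m * r ^ m = c * (2 ^ m * r ^ m)"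
          unfolding c_def distrib_right by simp
        ultimately have "dyadic_osc m ?h + 1 \<le> c * (2 ^ m * r ^ m)" by linarith
        then have "2 ^ m * (dyadic_osc m ?h + 1) \<le> 2 ^ m * (c * (2 ^ m * r ^ m))"
          by (intro mult_left_mono) auto
        also have "r ^ m = (2 ^ m) powr (q - 1 / 2)"
        proof -
          have "r ^ m = r powr real m" using r by (simp add: powr_realpow)
          also have "\<dots> = (2 powr real m) powr (q - 1 / 2)"
            unfolding r_def powr_powr by (simp add: mult.commute)
          finally show ?thesis by (simp add: powr_realpow)
        qed
        also have "2 ^ m * (c * (2 ^ m * (2 ^ m) powr (q - 1 / 2))) =
            c * ((2 ^ m) powr 1 * (2 ^ m) powr 1 * (2 ^ m) powr (q - 1 / 2))" by simp
        also have "\<dots> = c * (2 ^ m) powr (3 / 2 + q)"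
        proof -
          have "1 + 1 + (q - 1 / 2) = 3 / 2 + q" by simp
          then show ?thesis by (simp only: powr_add[symmetric])
        qed
        finally show ?case .
      qed
      moreover have "0 < c" using r by (simp add: c_def add_pos_pos)
      ultimately show "\<forall>\<^sub>F \<epsilon> in at_right 0. packing_exponent ?h \<epsilon> < u"
        using eventually_packing_exponent_le[OF h, of "3 / 2 + q" c u] q by auto
    qed
  qed
qed

end

theorem theorem1p8:
  fixes M :: "'a measure" and B :: "real \<Rightarrow> 'a \<Rightarrow> real" and f :: "real \<Rightarrow> real"
  assumes "standard_brownian_motion M B"
    and "continuous_on {0..1} f"
  shows "AE \<omega> in M.
      lower_minkowski_dim (graph_over {0..1} (\<lambda>t. B t \<omega> + f t)) =
        max (lower_minkowski_dim (graph_over {0..1} (\<lambda>t. B t \<omega>)))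
            (lower_minkowski_dim (graph_over {0..1} f)) \<and>
      upper_minkowski_dim (graph_over {0..1} (\<lambda>t. B t \<omega> + f t)) =
        max (lower_minkowski_dim (graph_over {0..1} (\<lambda>t. B t \<omega>)))
            (upper_minkowski_dim (graph_over {0..1} f))"
proof -
  interpret standard_brownian_motion M B by fact
  show ?thesis
    using continuous_paths AE_packing_exponent_ge[OF assms(2)]
      AE_packing_exponent_ge[OF continuous_on_const[of "{0..1}" 0]] AE_packing_exponent_le
  proof eventually_elim
    case (elim \<omega>)
    have B: "continuous_on {0..1} (\<lambda>t. B t \<omega>)"
      using elim(1) by (rule continuous_on_subset) auto
    \<comment> \<open>\<open>elim(3)\<close> is the lower bound with the zero function in place of
      \<open>f\<close>; it meets the upper bound \<open>elim(4)\<close> at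
      \<open>3 / 2\<close>.\<close>
    have lim: "(packing_exponent (\<lambda>t. B t \<omega>) \<longlongrightarrow> 3 / 2) (at_right 0)"
      using elim(3,4) by (intro order_tendstoI) auto
    note dims = minkowski_dim_graph_add[OF B assms(2) lim elim(2)[rule_format]]
    show ?case by (intro conjI dims)
  qed
qed

end
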